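(* Let $k\geqslant1$, $t\geqslant0$, and let $a_0,\dots,a_t$ and $x$ be independent variables. Then for all $n\geqslant1$, \[ \sum_{\sigma\in\operatorname{Sym}(N_{nk})}\ \sum_{\substack{(\alpha_1,\dots,\alpha_{nk})\in\{0,1,\dots,t\}^{nk}\\ \left[\frac{\sigma(i)-1}{k}\right]-\left[\frac{i-1}{k}\right]\equiv\alpha_i\ (\mathrm{mod}\ n)\ \forall i}}\Bigl(\prod_{i=1}^{nk}a_{\alpha_i}\Bigr)x^{\operatorname{Card}\{i\in N_{nk}:\sigma(i)<i,\ \alpha_i\not\equiv0\ (\mathrm{mod}\ n)\}+\sum_{i=1}^{nk}\left[\frac{\alpha_i}{n}\right]}=\sum_{r=0}^{kt}\operatorname{Tr}\Bigl(\bigl(\Pi_{r,t}^{[k]}(a_0,\dots,a_t)\bigr)^n\Bigr)x^r. \]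
   Context: $N_m=\{1,\dots,m\}$, $\operatorname{Sym}(N_m)$ its symmetric group, $[\cdot]$ the integer part. $i^{\langle l\rangle}$ denotes $i$ repeated $l$ times; $G_{r,t}^{[k]}=\{(1^{\langle l_1\rangle},\dots,t^{\langle l_t\rangle}):0\le l_i\le k,\ \sum l_i=r\}$. The matrix $\Pi_{r,t}^{[k]}(a_0,\dots,a_t)$ is indexed by $G_{r,t}^{[k]}$: $\Pi_{0,0}^{[k]}=k!a_0^k$; for $t\ge1$ and $\overline\alpha=(1^{\langle l_1\rangle},\dots,t^{\langle l_t\rangle})\in G_{r,t}^{[k]}$, entry $(\overline\alpha,\overline\beta)$ is $k!\binom{k}{l_t+\sum_{i=1}^{t-1}p_i}\prod_{i=1}^{t-1}\binom{l_i}{p_i}\,a_0^{k-l_t-\sum p_i}a_1^{p_1}\cdots a_{t-1}^{p_{t-1}}a_t^{l_t}$ if $\overline\beta=(1^{\langle l_t+\sum_{i=1}^{t-1}p_i\rangle},2^{\langle l_1-p_1\rangle},\dots,t^{\langle l_{t-1}-p_{t-1}\rangle})$ with integers $0\le p_i\le l_i$ and $\sum p_i\le k-l_t$; $0$ otherwise. *)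

theory Defs
  imports
    "HOL-Combinatorics.Permutations"
    "HOL-Number_Theory.Cong"
    "HOL-Library.FuncSet"
    "HOL-Library.List_Lexorder"
    "Jordan_Normal_Form.Matrix"
begin

(* word t l is the tuple (1^<l 1>, ..., t^<l t>); the multiplicity of i in it is recovered
   by count_list. *)
definition word :: "nat \<Rightarrow> (nat \<Rightarrow> nat) \<Rightarrow> nat list" where
  "word t l = concat (map (\<lambda>i. replicate (l i) i) [1..<Suc t])"

lemma count_list_word: "count_list (word t l) i = (if i \<in> {1..t} then l i else 0)"
proof -
  have rep: "count_list (replicate m j) i = (if i = j then m else 0)" for m j
    by (induction m) auto
  show ?thesis
    by (induction t) (auto simp: word_def rep)
qed

definition G :: "nat \<Rightarrow> nat \<Rightarrow> nat \<Rightarrow> nat list set" where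
  "G k r t = {word t l |l. (\<forall>i\<in>{1..t}. 0 \<le> l i \<and> l i \<le> k) \<and> (\<Sum>i=1..t. l i) = r}"

definition admissible :: "nat \<Rightarrow> nat \<Rightarrow> nat list \<Rightarrow> (nat \<Rightarrow> nat) set" where
  "admissible k t \<alpha> = {p \<in> \<Pi>\<^sub>E i\<in>{1..<t}. {0..count_list \<alpha> i}.
     count_list \<alpha> t + (\<Sum>i=1..<t. p i) \<le> k}"

definition successor :: "nat \<Rightarrow> nat list \<Rightarrow> (nat \<Rightarrow> nat) \<Rightarrow> nat list" where
  "successor t \<alpha> p = word t (\<lambda>j. if j = 1 then count_list \<alpha> t + (\<Sum>i=1..<t. p i)
                                else count_list \<alpha> (j - 1) - p (j - 1))"

(* At most one admissible p yields a given successor, so the description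
   operator in Pi_entry below denotes it. *)
lemma inj_on_successor: "inj_on (successor t \<alpha>) (admissible k t \<alpha>)"
proof (rule inj_onI)
  fix p q
  assume p: "p \<in> admissible k t \<alpha>" and q: "q \<in> admissible k t \<alpha>"
    and eq: "successor t \<alpha> p = successor t \<alpha> q"
  have E: "p \<in> (\<Pi>\<^sub>E i\<in>{1..<t}. {0..count_list \<alpha> i})" "q \<in> (\<Pi>\<^sub>E i\<in>{1..<t}. {0..count_list \<alpha> i})"
    using p q by (auto simp: admissible_def)
  show "p = q"
  proof (rule PiE_ext[OF E])
    fix i assume i: "i \<in> {1..<t}"
    have "count_list (successor t \<alpha> p) (Suc i) = count_list (successor t \<alpha> q) (Suc i)"
      using eq by simp
    then have "count_list \<alpha> i - p i = count_list \<alpha> i - q i"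
      using i by (simp add: successor_def count_list_word)
    moreover have "p i \<le> count_list \<alpha> i" "q i \<le> count_list \<alpha> i"
      using E i by (auto simp: PiE_iff)
    ultimately show "p i = q i" by linarith
  qed
qed

definition Pi_entry ::
  "nat \<Rightarrow> nat \<Rightarrow> (nat \<Rightarrow> 'a::comm_ring_1) \<Rightarrow> nat list \<Rightarrow> nat list \<Rightarrow> 'a" where
  "Pi_entry k t a \<alpha> \<beta> =
    (if t = 0 then of_nat (fact k) * a 0 ^ k
     else if \<exists>p\<in>admissible k t \<alpha>. \<beta> = successor t \<alpha> p then
       let p = (THE p. p \<in> admissible k t \<alpha> \<and> \<beta> = successor t \<alpha> p);
           s = count_list \<alpha> t + (\<Sum>i=1..<t. p i)
       in of_nat (fact k) * of_nat (k choose s)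
          * (\<Prod>i=1..<t. of_nat (count_list \<alpha> i choose p i))
          * a 0 ^ (k - s) * (\<Prod>i=1..<t. a i ^ p i) * a t ^ count_list \<alpha> t
     else 0)"

(* The index set G k r t is enumerated lexicographically; this choice affects the matrix only
   by simultaneous permutation of rows and columns, and does not affect traces of its powers. *)
definition Pi_mat :: "nat \<Rightarrow> nat \<Rightarrow> nat \<Rightarrow> (nat \<Rightarrow> 'a::comm_ring_1) \<Rightarrow> 'a mat" where
  "Pi_mat k r t a =
    (let gs = sorted_list_of_set (G k r t)
     in mat (length gs) (length gs) (\<lambda>(i, j). Pi_entry k t a (gs ! i) (gs ! j)))"

definition mat_trace :: "'a::comm_monoid_add mat \<Rightarrow> 'a" where
  "mat_trace A = (\<Sum>i<dim_row A. A $$ (i, i))"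

definition admissible_colourings :: "nat \<Rightarrow> nat \<Rightarrow> nat \<Rightarrow> (nat \<Rightarrow> nat) \<Rightarrow> (nat \<Rightarrow> nat) set" where
  "admissible_colourings k t n \<sigma> =
    {\<alpha> \<in> {1..n * k} \<rightarrow>\<^sub>E {0..t}. \<forall>i\<in>{1..n * k}.
       [(int (\<sigma> i) - 1) div int k - (int i - 1) div int k = int (\<alpha> i)] (mod int n)}"

end

theory Submission
  imports Defs
begin

text \<open>
  Cut the \<open>nk\<close> positions into \<open>n\<close> cyclically ordered blocks of size \<open>k\<close> and read a colour \<open>\<alpha>\<^sub>i\<close> as the
  instruction to throw \<open>i\<close> forward by \<open>\<alpha>\<^sub>i\<close> blocks. A colouring admits a permutation iff every block
  receives exactly \<open>k\<close> elements, and then it admits \<open>k!\<^sup>n\<close> of them; the exponent of \<open>x\<close> is the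
  number of times that the cut between the last and the first block is crossed.

  Let \<open>l\<^sup>m\<^sub>j\<close> be the number of elements thrown \<open>j\<close> blocks before block \<open>m\<close> whose colour is at least \<open>j\<close>.
  Block \<open>m\<close> receives \<open>k\<close> elements for all \<open>m\<close> iff \<open>l\<^sup>m\<^sub>1 + \<dots> + l\<^sup>m\<^sub>t\<close> does not depend on \<open>m\<close>, and this number
  is the exponent of \<open>x\<close>. The number of colourings with given \<open>l\<close> is the product over \<open>m\<close> and \<open>j\<close>
  of the binomials of \<open>l\<^sup>m\<^sub>j\<close> over \<open>l\<^sup>m\<^sup>+\<^sup>1\<^sub>j\<^sub>+\<^sub>1\<close> (with \<open>l\<^sup>m\<^sub>0 = k\<close>), and exactly
  \<open>l\<^sup>m\<^sub>j - l\<^sup>m\<^sup>+\<^sup>1\<^sub>j\<^sub>+\<^sub>1\<close> elements of colour \<open>j\<close> land at block \<open>m\<close>. Up to the factor \<open>k!\<close>, an entry of the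
  matrix is precisely the contribution of one \<open>m\<close>, so the trace of the \<open>n\<close>-th power sums over the
  closed walks \<open>l\<^sup>0, \<dots>, l\<^sup>n = l\<^sup>0\<close>.
\<close>

section \<open>Counting subsets, functions and permutations with prescribed fibres\<close>

text \<open>A subset splits into its intersections with the fibres of \<open>b\<close>, and these
  are chosen independently.\<close>

lemma card_subsets_prescribed_fibres:
  assumes "finite A" "finite M" "b ` A \<subseteq> M"
  shows "card {S. S \<subseteq> A \<and> (\<forall>m\<in>M. card {i\<in>S. b i = m} = e m)}
         = (\<Prod>m\<in>M. card {i\<in>A. b i = m} choose e m)"
proof -
  let ?T = "\<lambda>m. {S. S \<subseteq> {i\<in>A. b i = m} \<and> card S = e m}"
  \<comment> \<open>A family of subsets of the fibres is recovered from its union, since the fibres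
    are disjoint.\<close>
  have U: "(\<lambda>m\<in>M. {i \<in> (\<Union>m\<in>M. F m). b i = m}) = F" if F: "F \<in> Pi\<^sub>E M ?T" for F
  proof (rule extensionalityI[of _ M])
    show "F \<in> extensional M" using F by (simp add: PiE_def)
    fix m assume "m \<in> M"
    then show "(\<lambda>m\<in>M. {i \<in> (\<Union>m\<in>M. F m). b i = m}) m = F m"
      using F by (fastforce simp: PiE_iff)
  qed simp
  have "bij_betw (\<lambda>S. \<lambda>m\<in>M. {i\<in>S. b i = m})
      {S. S \<subseteq> A \<and> (\<forall>m\<in>M. card {i\<in>S. b i = m} = e m)} (Pi\<^sub>E M ?T)"
  proof (rule bij_betw_byWitness[where f' = "\<lambda>F. \<Union>m\<in>M. F m"])
    show "(\<lambda>F. \<Union>m\<in>M. F m) ` Pi\<^sub>E M ?T \<subseteq>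
        {S. S \<subseteq> A \<and> (\<forall>m\<in>M. card {i\<in>S. b i = m} = e m)}"
    proof clarify
      fix F assume F: "F \<in> Pi\<^sub>E M ?T"
      have "card {i \<in> (\<Union>m\<in>M. F m). b i = m} = e m" if "m \<in> M" for m
      proof -
        have "{i \<in> (\<Union>m\<in>M. F m). b i = m} = F m"
          using fun_cong[OF U[OF F], of m] that by simp
        then show ?thesis using F that by (auto simp: PiE_iff)
      qed
      moreover have "(\<Union>m\<in>M. F m) \<subseteq> A" using F by (fastforce simp: PiE_iff)
      ultimately show "(\<Union>m\<in>M. F m) \<subseteq> A \<and> (\<forall>m\<in>M. card {i \<in> (\<Union>m\<in>M. F m). b i = m} = e m)"
        by blast
    qed
    show "\<forall>S\<in>{S. S \<subseteq> A \<and> (\<forall>m\<in>M. card {i\<in>S. b i = m} = e m)}.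
        (\<Union>m\<in>M. (\<lambda>m\<in>M. {i\<in>S. b i = m}) m) = S"
      using assms(3) by fastforce
  qed (use U in auto)
  from bij_betw_same_card[OF this] show ?thesis
    using assms by (simp add: card_PiE n_subsets)
qed

text \<open>Induction on \<open>t\<close>: a function with values up to \<open>Suc t\<close> amounts
  to its truncation at \<open>t\<close> together with the set where the value \<open>Suc t\<close>
  is taken. That set is any subset of the top level set of the truncation with the right fibre
  sizes, so each step contributes one binomial per fibre.\<close>

lemma card_functions_prescribed_levels:
  fixes d :: "'m \<Rightarrow> nat \<Rightarrow> nat"
  assumes "finite A" "finite M" "b ` A \<subseteq> M"
    and d0: "\<And>m. m \<in> M \<Longrightarrow> d m 0 = card {i\<in>A. b i = m}"
  shows "card {\<alpha> \<in> A \<rightarrow>\<^sub>E {..t}. \<forall>m\<in>M. \<forall>j\<le>t. card {i\<in>A. b i = m \<and> j \<le> \<alpha> i} = d m j}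
         = (\<Prod>m\<in>M. \<Prod>j<t. d m j choose d m (Suc j))"
proof (induction t)
  case 0
  have "{\<alpha> \<in> A \<rightarrow>\<^sub>E {..0::nat}. \<forall>m\<in>M. \<forall>j\<le>0. card {i\<in>A. b i = m \<and> j \<le> \<alpha> i} = d m j}
      = A \<rightarrow>\<^sub>E {..0}"
    using d0 by auto
  then show ?case using assms by (simp add: card_PiE)
next
  case (Suc t)
  let ?X = "\<lambda>t. {\<alpha> \<in> A \<rightarrow>\<^sub>E {..t}. \<forall>m\<in>M. \<forall>j\<le>t. card {i\<in>A. b i = m \<and> j \<le> \<alpha> i} = d m j}"
  let ?Y = "\<lambda>\<alpha>. {S. S \<subseteq> {i\<in>A. t \<le> \<alpha> i} \<and> (\<forall>m\<in>M. card {i\<in>S. b i = m} = d m (Suc t))}"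
  let ?f = "\<lambda>(\<alpha>, S). \<lambda>i\<in>A. if i \<in> S then Suc t else \<alpha> i"
  let ?g = "\<lambda>\<alpha>. (\<lambda>i\<in>A. min (\<alpha> i) t, {i\<in>A. \<alpha> i = Suc t})"
  have "bij_betw ?f (Sigma (?X t) ?Y) (?X (Suc t))"
  proof (rule bij_betw_byWitness[where f' = ?g])
    show "\<forall>a\<in>Sigma (?X t) ?Y. ?g (?f a) = a"
    proof
      fix p assume "p \<in> Sigma (?X t) ?Y"
      then obtain \<alpha> S where p: "p = (\<alpha>, S)"
        and \<alpha>: "\<alpha> \<in> A \<rightarrow>\<^sub>E {..t}" and S: "S \<subseteq> {i\<in>A. t \<le> \<alpha> i}" by auto
      have le: "\<alpha> i \<le> t" if "i \<in> A" for i using \<alpha> that by auto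
      have "(\<lambda>i\<in>A. min (?f (\<alpha>, S) i) t) = \<alpha>"
      proof (rule extensionalityI[of _ A])
        fix i assume i: "i \<in> A"
        show "(\<lambda>i\<in>A. min (?f (\<alpha>, S) i) t) i = \<alpha> i" using le[OF i] S i by auto
      qed (use \<alpha> in \<open>auto simp: PiE_def\<close>)
      moreover have "{i\<in>A. ?f (\<alpha>, S) i = Suc t} = S"
        using S by (auto split: if_splits dest: le)
      ultimately show "?g (?f p) = p" by (simp add: p)
    qed
    show "\<forall>\<alpha>\<in>?X (Suc t). ?f (?g \<alpha>) = \<alpha>"
    proof
      fix \<alpha> assume "\<alpha> \<in> ?X (Suc t)"
      then have \<alpha>: "\<alpha> \<in> A \<rightarrow>\<^sub>E {..Suc t}" by blast
      have "?f (?g \<alpha>) i = \<alpha> i" if "i \<in> A" for i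
        using PiE_mem[OF \<alpha> that] that by auto
      moreover have "\<alpha> \<in> extensional A" using \<alpha> by (simp add: PiE_def)
      ultimately show "?f (?g \<alpha>) = \<alpha>" by (intro extensionalityI[of _ A]) auto
    qed
    show "?f ` Sigma (?X t) ?Y \<subseteq> ?X (Suc t)"
    proof (rule image_subsetI)
      fix p assume "p \<in> Sigma (?X t) ?Y"
      then obtain \<alpha> S where p: "p = (\<alpha>, S)"
        and \<alpha>: "\<alpha> \<in> A \<rightarrow>\<^sub>E {..t}" and S: "S \<subseteq> {i\<in>A. t \<le> \<alpha> i}"
        and lev: "\<forall>m\<in>M. \<forall>j\<le>t. card {i\<in>A. b i = m \<and> j \<le> \<alpha> i} = d m j"
        and card_S: "\<forall>m\<in>M. card {i\<in>S. b i = m} = d m (Suc t)" by auto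
      have le: "\<alpha> i \<le> t" if "i \<in> A" for i using \<alpha> that by auto
      have "card {i\<in>A. b i = m \<and> j \<le> ?f (\<alpha>, S) i} = d m j" if "m \<in> M" "j \<le> Suc t" for m j
      proof (cases "j = Suc t")
        case True
        have "{i\<in>A. b i = m \<and> j \<le> ?f (\<alpha>, S) i} = {i\<in>S. b i = m}"
          using True S by (auto split: if_splits dest: le)
        then show ?thesis using card_S that True by simp
      next
        case False
        then have "j \<le> t" using that by simp
        have "{i\<in>A. b i = m \<and> j \<le> ?f (\<alpha>, S) i} = {i\<in>A. b i = m \<and> j \<le> \<alpha> i}"
          using S that \<open>j \<le> t\<close> by (auto split: if_splits)
        then show ?thesis using lev that False by simp
      qed
      moreover have "?f (\<alpha>, S) \<in> A \<rightarrow>\<^sub>E {..Suc t}"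
        using le by (auto simp: le_SucI)
      ultimately show "?f p \<in> ?X (Suc t)" unfolding p by blast
    qed
    show "?g ` ?X (Suc t) \<subseteq> Sigma (?X t) ?Y"
    proof (rule image_subsetI)
      fix \<alpha> assume "\<alpha> \<in> ?X (Suc t)"
      then have \<alpha>: "\<alpha> \<in> A \<rightarrow>\<^sub>E {..Suc t}"
        and lev: "\<forall>m\<in>M. \<forall>j\<le>Suc t. card {i\<in>A. b i = m \<and> j \<le> \<alpha> i} = d m j" by blast+
      have le: "\<alpha> i \<le> Suc t" if "i \<in> A" for i using \<alpha> that by auto
      have "card {i\<in>A. b i = m \<and> j \<le> (\<lambda>i\<in>A. min (\<alpha> i) t) i} = d m j" if "m \<in> M" "j \<le> t" for m j
      proof -
        have "{i\<in>A. b i = m \<and> j \<le> (\<lambda>i\<in>A. min (\<alpha> i) t) i} = {i\<in>A. b i = m \<and> j \<le> \<alpha> i}"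
          using that by auto
        then show ?thesis using lev that by simp
      qed
      moreover have "card {i \<in> {i\<in>A. \<alpha> i = Suc t}. b i = m} = d m (Suc t)" if "m \<in> M" for m
      proof -
        have "{i \<in> {i\<in>A. \<alpha> i = Suc t}. b i = m} = {i\<in>A. b i = m \<and> Suc t \<le> \<alpha> i}"
          using le by (auto intro: le_antisym)
        then show ?thesis using lev that by simp
      qed
      ultimately show "?g \<alpha> \<in> Sigma (?X t) ?Y" by auto
    qed
  qed
  then have "card (?X (Suc t)) = card (Sigma (?X t) ?Y)" by (rule bij_betw_same_card[symmetric])
  also have "\<dots> = (\<Sum>\<alpha>\<in>?X t. card (?Y \<alpha>))"
    using assms by (intro card_SigmaI) (auto intro!: finite_PiE)
  \<comment> \<open>The number of choices depends on \<alpha> only through its level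
    \<open>t\<close>, whose sizes are prescribed.\<close>
  also have "\<dots> = (\<Sum>\<alpha>\<in>?X t. \<Prod>m\<in>M. d m t choose d m (Suc t))"
  proof (rule sum.cong[OF refl])
    fix \<alpha> assume "\<alpha> \<in> ?X t"
    moreover have "{i \<in> {i\<in>A. t \<le> \<alpha> i}. b i = m} = {i\<in>A. b i = m \<and> t \<le> \<alpha> i}" for m by auto
    ultimately show "card (?Y \<alpha>) = (\<Prod>m\<in>M. d m t choose d m (Suc t))"
      using assms by (subst card_subsets_prescribed_fibres) auto
  qed
  also have "\<dots> = (\<Prod>m\<in>M. \<Prod>j<Suc t. d m j choose d m (Suc j))"
    by (simp add: Suc prod.distrib)
  finally show ?case .
qed

text \<open>Points are inserted one at a time; the new image needs the right label and must avoid
  the images already used under that label. Truncated subtraction keeps this correct when a label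
  has too few elements in \<open>C\<close>, as a factor 0 then occurs.\<close>

lemma card_inj_prescribed_labels:
  assumes "finite A" "finite C" "finite M" "g ` A \<subseteq> M"
  shows "card {f \<in> A \<rightarrow>\<^sub>E C. inj_on f A \<and> (\<forall>i\<in>A. b (f i) = g i)}
         = (\<Prod>m\<in>M. \<Prod>j<card {i\<in>A. g i = m}. card {c\<in>C. b c = m} - j)"
  using assms(1,4)
proof (induction A rule: finite_induct)
  case empty
  then show ?case by (simp add: PiE_empty_domain)
next
  case (insert y A)
  let ?F = "\<lambda>A. {f \<in> A \<rightarrow>\<^sub>E C. inj_on f A \<and> (\<forall>i\<in>A. b (f i) = g i)}"
  let ?Y = "\<lambda>f. {c\<in>C. b c = g y} - f ` A"
  have "bij_betw (\<lambda>(f, c). f(y := c)) (Sigma (?F A) ?Y) (?F (insert y A))"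
  proof (rule bij_betw_byWitness[where f' = "\<lambda>f. (f(y := undefined), f y)"])
    show "\<forall>a\<in>Sigma (?F A) ?Y. (\<lambda>f. (f(y := undefined), f y)) ((\<lambda>(f, c). f(y := c)) a) = a"
    proof
      fix p assume "p \<in> Sigma (?F A) ?Y"
      then obtain f c where p: "p = (f, c)" "f \<in> A \<rightarrow>\<^sub>E C" by auto
      then have "f y = undefined" using insert.hyps by (auto simp: PiE_def extensional_def)
      then show "(\<lambda>f. (f(y := undefined), f y)) ((\<lambda>(f, c). f(y := c)) p) = p"
        using p by auto
    qed
    show "\<forall>f\<in>?F (insert y A). (\<lambda>(f, c). f(y := c)) (f(y := undefined), f y) = f" by auto
    show "(\<lambda>(f, c). f(y := c)) ` Sigma (?F A) ?Y \<subseteq> ?F (insert y A)"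
    proof (rule image_subsetI)
      fix p assume "p \<in> Sigma (?F A) ?Y"
      then obtain f c where p: "p = (f, c)"
        and f: "f \<in> A \<rightarrow>\<^sub>E C" "inj_on f A" "\<forall>i\<in>A. b (f i) = g i"
        and c: "c \<in> C" "b c = g y" "c \<notin> f ` A" by auto
      have "inj_on (f(y := c)) A" using f(2) insert.hyps by (simp add: inj_on_fun_updI c(3))
      moreover have "(f(y := c)) ` A = f ` A" using insert.hyps by auto
      ultimately have "inj_on (f(y := c)) (insert y A)"
        using c insert.hyps by (simp add: inj_on_insert)
      moreover have "f(y := c) \<in> insert y A \<rightarrow>\<^sub>E C" using f(1) c(1) by (rule PiE_fun_upd[rotated])
      moreover have "\<forall>i\<in>insert y A. b ((f(y := c)) i) = g i" using f(3) c(2) by simp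
      ultimately show "(\<lambda>(f, c). f(y := c)) p \<in> ?F (insert y A)" unfolding p by simp
    qed
    show "(\<lambda>f. (f(y := undefined), f y)) ` ?F (insert y A) \<subseteq> Sigma (?F A) ?Y"
    proof (rule image_subsetI)
      fix f assume "f \<in> ?F (insert y A)"
      then have f: "f \<in> insert y A \<rightarrow>\<^sub>E C" "inj_on f (insert y A)"
        "\<forall>i\<in>insert y A. b (f i) = g i" by blast+
      define f' where "f' = f(y := undefined)"
      have eq: "f' i = f i" if "i \<in> A" for i using that insert.hyps by (auto simp: f'_def)
      then have im: "f' ` A = f ` A" by (rule image_cong[OF refl])
      have "inj_on f' A"
        using f(2) inj_on_cong[of A f' f] eq by (simp add: inj_on_insert)
      moreover have "f' \<in> A \<rightarrow>\<^sub>E C"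
        using f(1) insert.hyps by (auto simp: f'_def PiE_iff extensional_def)
      moreover have "f y \<notin> f ` A" using f(2) insert.hyps by (auto simp: inj_on_def)
      ultimately have "(f', f y) \<in> Sigma (?F A) ?Y"
        unfolding im[symmetric] using f(1,3) eq by (intro SigmaI) auto
      then show "(f(y := undefined), f y) \<in> Sigma (?F A) ?Y" by (simp add: f'_def)
    qed
  qed
  then have "card (?F (insert y A)) = card (Sigma (?F A) ?Y)"
    by (rule bij_betw_same_card[symmetric])
  also have "\<dots> = (\<Sum>f\<in>?F A. card (?Y f))"
    using assms insert.hyps by (intro card_SigmaI) (auto intro!: finite_PiE)
  also have "\<dots> = (\<Sum>f\<in>?F A. card {c\<in>C. b c = g y} - card {i\<in>A. g i = g y})"
  proof (rule sum.cong[OF refl])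
    fix f assume f: "f \<in> ?F A"
    \<comment> \<open>As \<open>f\<close> respects labels, the values with label \<open>g y\<close>
      already taken are the images of the points with that label, and by injectivity equally
      many.\<close>
    have iff: "b (f i) = g y \<longleftrightarrow> g i = g y" if "i \<in> A" for i using f that by simp
    have fibre: "{i\<in>A. g i = g y} = {i\<in>A. b (f i) = g y}"
      by (rule Collect_cong) (simp add: iff cong: conj_cong)
    have "?Y f = {c\<in>C. b c = g y} - f ` {i\<in>A. g i = g y}" unfolding fibre by blast
    moreover have "card (f ` {i\<in>A. g i = g y}) = card {i\<in>A. g i = g y}"
      using f by (intro card_image) (auto intro: inj_on_subset)
    moreover have "f ` {i\<in>A. g i = g y} \<subseteq> {c\<in>C. b c = g y}"
      unfolding fibre using f by fast
    ultimately show "card (?Y f) = card {c\<in>C. b c = g y} - card {i\<in>A. g i = g y}"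
      using insert.hyps by (simp add: card_Diff_subset)
  qed
  also have "\<dots> = (\<Prod>m\<in>M. \<Prod>j<card {i\<in>A. g i = m}. card {c\<in>C. b c = m} - j)
      * (card {c\<in>C. b c = g y} - card {i\<in>A. g i = g y})"
    using insert by simp
  also have "\<dots> = (\<Prod>m\<in>M. \<Prod>j<card {i\<in>insert y A. g i = m}. card {c\<in>C. b c = m} - j)"
  proof -
    \<comment> \<open>Only the product for \<open>m = g y\<close> changes, by one new last
      factor.\<close>
    have "{i\<in>insert y A. g i = m} = (if m = g y then insert y {i\<in>A. g i = m} else {i\<in>A. g i = m})"
      for m by auto
    then have "card {i\<in>insert y A. g i = m} = (if m = g y then Suc (card {i\<in>A. g i = m}) else card {i\<in>A. g i = m})"
      for m using insert.hyps by simp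
    moreover have "g y \<in> M" using insert.prems by simp
    ultimately show ?thesis
      using assms(3) by (simp add: prod.remove[of M "g y"] mult_ac)
  qed
  finally show ?case .
qed

text \<open>With all fibres of \<open>b\<close> of size \<open>k\<close>, each falling factorial in
  the count of injections becomes \<open>fact k\<close>. If some fibre of \<open>g\<close> has
  another size, nothing qualifies: a permutation would map it bijectively onto the fibre of
  \<open>b\<close> over the same point.\<close>

lemma card_permutes_prescribed_labels:
  assumes "finite A" "finite M" "b ` A \<subseteq> M" "g ` A \<subseteq> M"
    and k: "\<And>m. m \<in> M \<Longrightarrow> card {i\<in>A. b i = m} = k"
  shows "card {\<sigma>. \<sigma> permutes A \<and> (\<forall>i\<in>A. b (\<sigma> i) = g i)}
         = (if \<forall>m\<in>M. card {i\<in>A. g i = m} = k then fact k ^ card M else 0)"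
proof -
  let ?F = "{f \<in> A \<rightarrow>\<^sub>E A. inj_on f A \<and> (\<forall>i\<in>A. b (f i) = g i)}"
  let ?P = "{\<sigma>. \<sigma> permutes A \<and> (\<forall>i\<in>A. b (\<sigma> i) = g i)}"
  have bij: "bij_betw (\<lambda>\<sigma>. restrict \<sigma> A) ?P ?F"
  proof (rule bij_betw_byWitness[where f' = "\<lambda>f i. if i \<in> A then f i else i"])
    show "\<forall>\<sigma>\<in>?P. (\<lambda>i. if i \<in> A then restrict \<sigma> A i else i) = \<sigma>"
      by (auto simp: fun_eq_iff permutes_def)
    show "\<forall>f\<in>?F. restrict (\<lambda>i. if i \<in> A then f i else i) A = f"
      by (auto simp: fun_eq_iff PiE_def extensional_def)
    show "(\<lambda>\<sigma>. restrict \<sigma> A) ` ?P \<subseteq> ?F"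
      by (auto simp: permutes_in_image permutes_inj_on inj_on_restrict_eq)
    show "(\<lambda>f i. if i \<in> A then f i else i) ` ?F \<subseteq> ?P"
    proof clarify
      fix f assume f: "f \<in> A \<rightarrow>\<^sub>E A" "inj_on f A" "\<forall>i\<in>A. b (f i) = g i"
      have "f ` A = A" using f assms(1) by (intro card_subset_eq) (auto simp: card_image)
      then have "bij_betw f A A" using f by (simp add: bij_betw_def)
      then have "bij_betw (\<lambda>i. if i \<in> A then f i else i) A A"
        by (subst bij_betw_cong[of A _ f]) auto
      then have "(\<lambda>i. if i \<in> A then f i else i) permutes A" by (intro bij_imp_permutes) auto
      then show "(\<lambda>i. if i \<in> A then f i else i) permutes A \<and>
          (\<forall>i\<in>A. b (if i \<in> A then f i else i) = g i)" using f by auto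
    qed
  qed
  show ?thesis
  proof (cases "\<forall>m\<in>M. card {i\<in>A. g i = m} = k")
    case True
    have "(\<Prod>j<k. k - j) = fact k"
      by (simp add: fact_prod_rev atLeast0LessThan)
    then show ?thesis
      using bij_betw_same_card[OF bij] card_inj_prescribed_labels[OF assms(1,1,2,4), of b] True k
      by simp
  next
    case False
    have "?P = {}"
    proof (rule ccontr)
      assume "?P \<noteq> {}"
      then obtain \<sigma> where \<sigma>: "\<sigma> permutes A" "\<forall>i\<in>A. b (\<sigma> i) = g i" by blast
      have "card {i\<in>A. g i = m} = k" if "m \<in> M" for m
      proof -
        have "bij_betw \<sigma> {i\<in>A. g i = m} {i\<in>A. b i = m}"
        proof (rule bij_betw_imageI)
          show "inj_on \<sigma> {i \<in> A. g i = m}" using \<sigma>(1) by (rule permutes_inj_on)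
          show "\<sigma> ` {i \<in> A. g i = m} = {i \<in> A. b i = m}"
          proof
            show "{i \<in> A. b i = m} \<subseteq> \<sigma> ` {i \<in> A. g i = m}"
            proof
              fix i assume i: "i \<in> {i \<in> A. b i = m}"
              then obtain j where "j \<in> A" "i = \<sigma> j" using permutes_image[OF \<sigma>(1)] by blast
              then show "i \<in> \<sigma> ` {i \<in> A. g i = m}" using i \<sigma>(2) by auto
            qed
          qed (use \<sigma> in \<open>auto simp: permutes_in_image\<close>)
        qed
        then show ?thesis using bij_betw_same_card k that by force
      qed
      with False show False by blast
    qed
    then show ?thesis using False by (simp only: card.empty if_False)
  qed
qed

section \<open>Traces of matrix powers as sums over closed walks\<close>

text \<open>Expanding the last matrix product appends one vertex. A walk records the
  \<open>Suc n\<close> vertices before the fixed endpoint \<open>h j\<close>; its start is imposed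
  by an indicator, so that the range of summation remains a full function space.\<close>

lemma mat_power_index_eq_sum_walks:
  fixes A :: "'a::comm_ring_1 mat"
  assumes A: "A \<in> carrier_mat N N" and h: "bij_betw h {..<N} S" and fin: "finite S"
    and F: "\<And>i j. i < N \<Longrightarrow> j < N \<Longrightarrow> A $$ (i, j) = F (h i) (h j)"
    and ij: "i < N" "j < N"
  shows "(A ^\<^sub>m Suc n) $$ (i, j)
         = (\<Sum>f\<in>{..n} \<rightarrow>\<^sub>E S. if f 0 = h i then (\<Prod>m<n. F (f m) (f (Suc m))) * F (f n) (h j) else 0)"
  using ij(2)
proof (induction n arbitrary: j)
  case 0
  have hi: "h i \<in> S" using h ij by (auto simp: bij_betw_def)
  have "(\<Sum>f\<in>{..0::nat} \<rightarrow>\<^sub>E S. if f 0 = h i then F (f 0) (h j) else 0)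
      = (\<Sum>s\<in>S. if s = h i then F s (h j) else 0)"
  proof (rule sum.reindex_bij_witness[where i = "\<lambda>s. \<lambda>m\<in>{..0}. s" and j = "\<lambda>f. f 0"])
    fix f assume "f \<in> {..0::nat} \<rightarrow>\<^sub>E S"
    then show "(\<lambda>m\<in>{..0}. f 0) = f" by (auto simp: fun_eq_iff PiE_def extensional_def)
  qed auto
  then show ?case using A fin hi ij F 0 by (simp add: left_mult_one_mat[of A N N] cong: if_cong)
next
  case (Suc n)
  let ?w = "\<lambda>n f s. if f 0 = h i then (\<Prod>m<n. F (f m) (f (Suc m))) * F (f n) s else 0"
  have c: "A ^\<^sub>m Suc n \<in> carrier_mat N N" using A by (rule pow_carrier_mat)
  have "(A ^\<^sub>m Suc (Suc n)) $$ (i, j) = (A ^\<^sub>m Suc n * A) $$ (i, j)" by simp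
  also have "\<dots> = (\<Sum>l<N. (A ^\<^sub>m Suc n) $$ (i, l) * A $$ (l, j))"
    using c A ij Suc.prems by (simp add: scalar_prod_def atLeast0LessThan del: pow_mat.simps)
  \<comment> \<open>The induction hypothesis is used with the summation index \<open>l\<close> as
    endpoint.\<close>
  also have "\<dots> = (\<Sum>l<N. (\<Sum>f\<in>{..n} \<rightarrow>\<^sub>E S. ?w n f (h l)) * F (h l) (h j))"
    using Suc F by (intro sum.cong) (auto simp del: pow_mat.simps)
  also have "\<dots> = (\<Sum>s\<in>S. (\<Sum>f\<in>{..n} \<rightarrow>\<^sub>E S. ?w n f s) * F s (h j))"
    by (rule sum.reindex_bij_betw[OF h])
  also have "\<dots> = (\<Sum>(s, f)\<in>S \<times> ({..n} \<rightarrow>\<^sub>E S). ?w n f s * F s (h j))"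
    by (simp add: sum_distrib_right sum.cartesian_product)
  \<comment> \<open>The former endpoint \<open>s\<close> becomes the vertex at
    \<open>Suc n\<close>.\<close>
  also have "\<dots> = (\<Sum>f\<in>{..Suc n} \<rightarrow>\<^sub>E S. ?w (Suc n) f (h j))"
  proof (rule sum.reindex_bij_witness[where i = "\<lambda>f. (f (Suc n), f(Suc n := undefined))"
          and j = "\<lambda>(s, f). f(Suc n := s)"])
    fix p assume "p \<in> S \<times> ({..n} \<rightarrow>\<^sub>E S)"
    then obtain s f where p: "p = (s, f)" "s \<in> S" "f \<in> {..n} \<rightarrow>\<^sub>E S" by auto
    then have u: "f (Suc n) = undefined" by (auto simp: PiE_def extensional_def)
    show "(\<lambda>f. (f (Suc n), f(Suc n := undefined))) ((\<lambda>(s, f). f(Suc n := s)) p) = p"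
      using p u by auto
    show "(\<lambda>(s, f). f(Suc n := s)) p \<in> {..Suc n} \<rightarrow>\<^sub>E S"
      using p by (auto simp: PiE_def extensional_def Pi_def le_Suc_eq)
    show "?w (Suc n) ((\<lambda>(s, f). f(Suc n := s)) p) (h j) = (\<lambda>(s, f). ?w n f s * F s (h j)) p"
      using p by auto
  next
    fix f assume f: "f \<in> {..Suc n} \<rightarrow>\<^sub>E S"
    show "(\<lambda>(s, f). f(Suc n := s)) ((\<lambda>f. (f (Suc n), f(Suc n := undefined))) f) = f" by auto
    show "(f (Suc n), f(Suc n := undefined)) \<in> S \<times> ({..n} \<rightarrow>\<^sub>E S)"
      using f by (auto simp: PiE_iff extensional_def)
  qed
  finally show ?case .
qed

text \<open>On the diagonal a walk returns to its start, which then ranges freely; the successor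
  index can be read modulo \<open>n\<close>.\<close>

lemma mat_trace_power_closed_walks:
  fixes A :: "'a::comm_ring_1 mat"
  assumes A: "A \<in> carrier_mat N N" and h: "bij_betw h {..<N} S" and fin: "finite S"
    and F: "\<And>i j. i < N \<Longrightarrow> j < N \<Longrightarrow> A $$ (i, j) = F (h i) (h j)"
    and n: "n \<ge> 1"
  shows "mat_trace (A ^\<^sub>m n) = (\<Sum>f\<in>{..<n} \<rightarrow>\<^sub>E S. \<Prod>m<n. F (f m) (f (Suc m mod n)))"
proof -
  obtain n' where n': "n = Suc n'" using n by (cases n) auto
  have c: "A ^\<^sub>m n \<in> carrier_mat N N" using A by (rule pow_carrier_mat)
  let ?W = "\<lambda>f s. (\<Prod>m<n'. F (f m) (f (Suc m))) * F (f n') s"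
  have "mat_trace (A ^\<^sub>m n) = (\<Sum>i<N. (A ^\<^sub>m Suc n') $$ (i, i))"
    using c by (auto simp: mat_trace_def n' simp del: pow_mat.simps)
  also have "\<dots> = (\<Sum>i<N. \<Sum>f\<in>{..n'} \<rightarrow>\<^sub>E S. if f 0 = h i then ?W f (h i) else 0)"
    by (intro sum.cong refl) (use mat_power_index_eq_sum_walks[where F = F, OF A h fin F] in blast)
  also have "\<dots> = (\<Sum>s\<in>S. \<Sum>f\<in>{..n'} \<rightarrow>\<^sub>E S. if f 0 = s then ?W f s else 0)"
    by (rule sum.reindex_bij_betw[OF h])
  also have "\<dots> = (\<Sum>f\<in>{..n'} \<rightarrow>\<^sub>E S. \<Sum>s\<in>S. if f 0 = s then ?W f s else 0)"
    by (rule sum.swap)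
  \<comment> \<open>Only \<open>s = f 0\<close> survives in the inner sum.\<close>
  also have "\<dots> = (\<Sum>f\<in>{..n'} \<rightarrow>\<^sub>E S. ?W f (f 0))"
    using fin by (intro sum.cong refl) (auto simp: PiE_iff)
  \<comment> \<open>The step out of \<open>n'\<close> ends at
    \<open>Suc n' mod n = 0\<close>.\<close>
  also have "\<dots> = (\<Sum>f\<in>{..<n} \<rightarrow>\<^sub>E S. \<Prod>m<n. F (f m) (f (Suc m mod n)))"
    by (simp add: n' lessThan_Suc_atMost[symmetric])
  finally show ?thesis .
qed

section \<open>Matrix entries and closed walks in terms of multiplicity functions\<close>

definition states :: "nat \<Rightarrow> nat \<Rightarrow> (nat \<Rightarrow> nat) set" where
  "states k t = {1..t} \<rightarrow>\<^sub>E {0..k}"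

text \<open>With the conventions \<open>l\<^sub>0 = k\<close> and \<open>l\<^sub>j = 0\<close> for \<open>j > t\<close>,
  all factors of an entry of the matrix take the same form; see \<open>Pi_entry_word\<close>.\<close>

definition pad :: "nat \<Rightarrow> nat \<Rightarrow> (nat \<Rightarrow> nat) \<Rightarrow> nat \<Rightarrow> nat" where
  "pad k t l j = (if j = 0 then k else if j \<le> t then l j else 0)"

lemma finite_states: "finite (states k t)"
  unfolding states_def by (intro finite_PiE) auto

lemma word_cong: "(\<And>i. i \<in> {1..t} \<Longrightarrow> l i = l' i) \<Longrightarrow> word t l = word t l'"
  unfolding word_def by (intro arg_cong[where f = concat] map_cong) auto

text \<open>\<open>count_list\<close> recovers the multiplicities on \<open>{1..t}\<close>, and
  extensionality fixes the function elsewhere.\<close>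

lemma bij_betw_word:
  "bij_betw (word t) {l \<in> states k t. (\<Sum>i=1..t. l i) = r} (G k r t)"
proof (rule bij_betw_imageI)
  show "inj_on (word t) {l \<in> states k t. (\<Sum>i=1..t. l i) = r}"
  proof (rule inj_onI)
    fix l l' assume l: "l \<in> {l \<in> states k t. (\<Sum>i=1..t. l i) = r}"
      and l': "l' \<in> {l \<in> states k t. (\<Sum>i=1..t. l i) = r}" and eq: "word t l = word t l'"
    show "l = l'"
    proof (rule extensionalityI[of _ "{1..t}"])
      fix i assume "i \<in> {1..t}"
      then show "l i = l' i" using count_list_word[of t l i] count_list_word[of t l' i] eq by simp
    qed (use l l' in \<open>auto simp: states_def PiE_def\<close>)
  qed
  show "word t ` {l \<in> states k t. (\<Sum>i=1..t. l i) = r} = G k r t"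
  proof
    show "word t ` {l \<in> states k t. (\<Sum>i=1..t. l i) = r} \<subseteq> G k r t"
      unfolding G_def states_def by fastforce
    show "G k r t \<subseteq> word t ` {l \<in> states k t. (\<Sum>i=1..t. l i) = r}"
    proof
      fix w assume "w \<in> G k r t"
      then obtain l where l: "w = word t l" "\<forall>i\<in>{1..t}. l i \<le> k" "(\<Sum>i=1..t. l i) = r"
        unfolding G_def by blast
      have "word t (restrict l {1..t}) = w" unfolding l(1) by (rule word_cong) simp
      moreover have "restrict l {1..t} \<in> {l \<in> states k t. (\<Sum>i=1..t. l i) = r}"
        using l by (auto simp: states_def)
      ultimately show "w \<in> word t ` {l \<in> states k t. (\<Sum>i=1..t. l i) = r}" by blast
    qed
  qed
qed

text \<open>\<open>inj_on_successor\<close> identifies the \<open>THE\<close> in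
  \<open>Pi_entry\<close> with the given \<open>p\<close>.\<close>

lemma Pi_entry_successor:
  assumes "t \<ge> 1" "p \<in> admissible k t \<alpha>"
  shows "Pi_entry k t a \<alpha> (successor t \<alpha> p)
    = (let s = count_list \<alpha> t + (\<Sum>i=1..<t. p i)
       in of_nat (fact k) * of_nat (k choose s)
          * (\<Prod>i=1..<t. of_nat (count_list \<alpha> i choose p i))
          * a 0 ^ (k - s) * (\<Prod>i=1..<t. a i ^ p i) * a t ^ count_list \<alpha> t)"
proof -
  have "(THE q. q \<in> admissible k t \<alpha> \<and> successor t \<alpha> p = successor t \<alpha> q) = p"
    using assms(2) inj_on_successor[of t \<alpha> k] by (intro the_equality) (auto dest: inj_onD)
  moreover have "t \<noteq> 0" using assms(1) by simp
  moreover have "\<exists>q\<in>admissible k t \<alpha>. successor t \<alpha> p = successor t \<alpha> q" using assms(2) by blast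
  ultimately show ?thesis unfolding Pi_entry_def by (simp only: if_True if_False Let_def)
qed

text \<open>The target forces \<open>p j = l j - l' (Suc j)\<close>, and equality of the sums then
  gives the required value of \<open>l' 1\<close>. If some difference would be negative, no
  \<open>p\<close> exists and a binomial on the right vanishes.\<close>

lemma Pi_entry_word:
  fixes a :: "nat \<Rightarrow> 'a::comm_ring_1"
  assumes l: "l \<in> states k t" and l': "l' \<in> states k t"
    and sum_eq: "(\<Sum>i=1..t. l i) = (\<Sum>i=1..t. l' i)"
  shows "Pi_entry k t a (word t l) (word t l')
    = of_nat (fact k) * (\<Prod>j\<le>t. of_nat (pad k t l j choose pad k t l' (Suc j))
                        * a j ^ (pad k t l j - pad k t l' (Suc j)))"
proof (cases "t = 0")
  case True
  then show ?thesis by (simp add: Pi_entry_def pad_def)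
next
  case False
  have c: "count_list (word t l) i = l i" if "i \<in> {1..t}" for i
    using that by (simp add: count_list_word)
  have split: "{..t} = insert 0 (insert t {1..<t})" using False by auto
  show ?thesis
  proof (cases "\<forall>j\<in>{1..<t}. l' (Suc j) \<le> l j")
    case True
    define p where "p = (\<lambda>j\<in>{1..<t}. l j - l' (Suc j))"
    have "(\<Sum>i=1..t. l i) = (\<Sum>j=1..<t. l j) + l t"
      using False by (simp add: sum.last_plus add.commute)
    moreover have "(\<Sum>i=1..t. l' i) = l' 1 + (\<Sum>j=1..<t. l' (Suc j))"
    proof -
      have "(\<Sum>i=1..t. l' i) = l' 1 + (\<Sum>i=Suc 1..t. l' i)"
        using False by (simp add: sum.atLeast_Suc_atMost)
      also have "(\<Sum>i=Suc 1..t. l' i) = (\<Sum>j=1..<t. l' (Suc j))"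
        using False
        by (intro sum.reindex_bij_witness[where i = Suc and j = "\<lambda>i. i - 1"]) auto
      finally show ?thesis .
    qed
    moreover have "(\<Sum>j=1..<t. p j) + (\<Sum>j=1..<t. l' (Suc j)) = (\<Sum>j=1..<t. l j)"
      unfolding sum.distrib[symmetric] using True by (intro sum.cong) (auto simp: p_def)
    ultimately have s: "count_list (word t l) t + (\<Sum>i=1..<t. p i) = l' 1"
      using sum_eq False by (simp add: c)
    \<comment> \<open>This is the bound on the total that \<open>admissible\<close> demands.\<close>
    have "l' 1 \<le> k" using l' False by (auto simp: states_def)
    then have p: "p \<in> admissible k t (word t l)"
      using s by (auto simp: admissible_def p_def c)
    have succ: "successor t (word t l) p = word t l'"
      unfolding successor_def
    proof (rule word_cong)
      fix i assume i: "i \<in> {1..t}"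
      show "(if i = 1 then count_list (word t l) t + sum p {1..<t}
             else count_list (word t l) (i - 1) - p (i - 1)) = l' i"
      proof (cases "i = 1")
        case True then show ?thesis using s by simp
      next
        case False
        then have i': "i - 1 \<in> {1..<t}" "Suc (i - 1) = i" using i by auto
        then have "l' i \<le> l (i - 1)" using True by metis
        then show ?thesis using False i' by (auto simp: p_def c)
      qed
    qed
    have "Pi_entry k t a (word t l) (word t l') = of_nat (fact k) * of_nat (k choose l' 1)
          * (\<Prod>i=1..<t. of_nat (l i choose p i))
          * a 0 ^ (k - l' 1) * (\<Prod>i=1..<t. a i ^ p i) * a t ^ l t"
      using Pi_entry_successor[OF _ p, of a] False unfolding succ s Let_def by (simp add: c)
    \<comment> \<open>Choosing \<open>p i\<close> elements is the same as choosing the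
      \<open>l' (Suc i)\<close> others.\<close>
    also have "(\<Prod>i=1..<t. of_nat (l i choose p i)) = (\<Prod>i=1..<t. of_nat (l i choose l' (Suc i)) :: 'a)"
      using True by (intro prod.cong refl) (simp add: p_def binomial_symmetric[symmetric])
    also have "(\<Prod>i=1..<t. a i ^ p i) = (\<Prod>i=1..<t. a i ^ (l i - l' (Suc i)))"
      by (intro prod.cong) (auto simp: p_def)
    \<comment> \<open>The isolated factors belong to \<open>j = 0\<close>, where \<open>pad\<close>
      gives \<open>k\<close>, and to \<open>j = t\<close>, where \<open>l'\<close> is padded by 0
      and the binomial is 1.\<close>
    finally show ?thesis
      using False by (simp add: split pad_def prod.distrib mult_ac)
  next
    case no: False
    then obtain j where j: "j \<in> {1..<t}" "l j < l' (Suc j)" by (auto simp: not_le)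
    \<comment> \<open>Truncated subtraction leaves at most \<open>l j\<close> letters
      \<open>Suc j\<close> in a successor.\<close>
    have "word t l' \<noteq> successor t (word t l) p" for p
    proof
      assume "word t l' = successor t (word t l) p"
      then have "count_list (word t l') (Suc j) = count_list (successor t (word t l) p) (Suc j)"
        by simp
      then show False using j by (simp add: successor_def count_list_word)
    qed
    then have "Pi_entry k t a (word t l) (word t l') = 0"
      using False by (simp add: Pi_entry_def)
    moreover have "(\<Prod>j\<le>t. of_nat (pad k t l j choose pad k t l' (Suc j))
                        * a j ^ (pad k t l j - pad k t l' (Suc j))) = 0"
    proof (rule prod_zero)
      show "\<exists>j\<in>{..t}. of_nat (pad k t l j choose pad k t l' (Suc j))
                        * a j ^ (pad k t l j - pad k t l' (Suc j)) = 0"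
        using j by (intro bexI[of _ j]) (auto simp: pad_def binomial_eq_0)
    qed simp
    ultimately show ?thesis by simp
  qed
qed

text \<open>The factor \<open>fact k\<close> of each entry is left out: it will account for the
  permutations, and the binomials for the colourings.\<close>

definition walk_weight :: "nat \<Rightarrow> nat \<Rightarrow> nat \<Rightarrow> (nat \<Rightarrow> 'a::comm_ring_1) \<Rightarrow> (nat \<Rightarrow> nat \<Rightarrow> nat) \<Rightarrow> 'a" where
  "walk_weight k t n a f =
    (\<Prod>m<n. \<Prod>j\<le>t. of_nat (pad k t (f m) j choose pad k t (f (Suc m mod n)) (Suc j))
        * a j ^ (pad k t (f m) j - pad k t (f (Suc m mod n)) (Suc j)))"

lemma mat_trace_Pi_mat_power:
  fixes a :: "nat \<Rightarrow> 'a::comm_ring_1"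
  assumes n: "n \<ge> 1"
  shows "mat_trace (Pi_mat k r t a ^\<^sub>m n)
    = (\<Sum>f\<in>{..<n} \<rightarrow>\<^sub>E {l \<in> states k t. (\<Sum>i=1..t. l i) = r}. of_nat (fact k) ^ n * walk_weight k t n a f)"
proof -
  let ?L = "{l \<in> states k t. (\<Sum>i=1..t. l i) = r}"
  let ?gs = "sorted_list_of_set (G k r t)"
  \<comment> \<open>Composing the enumeration with the inverse of \<open>word\<close> makes the
    walks run through states, independently of the order of the words.\<close>
  define h where "h = inv_into ?L (word t) \<circ> (!) ?gs"
  have fin: "finite ?L" using finite_states by simp
  have finG: "finite (G k r t)" using bij_betw_finite[OF bij_betw_word] fin by blast
  have nth: "bij_betw ((!) ?gs) {..<length ?gs} (G k r t)"
    using finG by (intro bij_betw_nth) auto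
  have h: "bij_betw h {..<length ?gs} ?L"
    unfolding h_def by (rule bij_betw_trans[OF nth bij_betw_inv_into[OF bij_betw_word]])
  have word_h: "word t (h i) = ?gs ! i" if "i < length ?gs" for i
  proof -
    have "?gs ! i \<in> word t ` ?L"
      using bij_betw_imp_surj_on[OF bij_betw_word] bij_betwE[OF nth] that by blast
    then show ?thesis unfolding h_def comp_def by (rule f_inv_into_f)
  qed
  have "mat_trace (Pi_mat k r t a ^\<^sub>m n)
      = (\<Sum>f\<in>{..<n} \<rightarrow>\<^sub>E ?L. \<Prod>m<n. Pi_entry k t a (word t (f m)) (word t (f (Suc m mod n))))"
    by (rule mat_trace_power_closed_walks[OF _ h fin _ n]) (auto simp: Pi_mat_def Let_def word_h)
  also have "\<dots> = (\<Sum>f\<in>{..<n} \<rightarrow>\<^sub>E ?L. of_nat (fact k) ^ n * walk_weight k t n a f)"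
  proof (rule sum.cong[OF refl])
    fix f assume f: "f \<in> {..<n} \<rightarrow>\<^sub>E ?L"
    have "Pi_entry k t a (word t (f m)) (word t (f (Suc m mod n)))
        = of_nat (fact k) * (\<Prod>j\<le>t. of_nat (pad k t (f m) j choose pad k t (f (Suc m mod n)) (Suc j))
        * a j ^ (pad k t (f m) j - pad k t (f (Suc m mod n)) (Suc j)))" if "m < n" for m
    proof (rule Pi_entry_word)
      have "f m \<in> ?L" "f (Suc m mod n) \<in> ?L" using f that by (auto simp: PiE_iff)
      then show "f m \<in> states k t" "f (Suc m mod n) \<in> states k t"
        "(\<Sum>i=1..t. f m i) = (\<Sum>i=1..t. f (Suc m mod n) i)" by auto
    qed
    then show "(\<Prod>m<n. Pi_entry k t a (word t (f m)) (word t (f (Suc m mod n))))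
        = of_nat (fact k) ^ n * walk_weight k t n a f"
      by (simp add: walk_weight_def prod.distrib)
  qed
  finally show ?thesis .
qed

text \<open>For fixed \<open>r\<close> the walks have constant total \<open>r\<close>; summing over
  \<open>r\<close> leaves only the condition that the total is constant.\<close>

lemma sum_trace_Pi_mat_power:
  fixes a :: "nat \<Rightarrow> 'a::comm_ring_1" and x :: 'a
  assumes n: "n \<ge> 1"
  shows "(\<Sum>r=0..k * t. mat_trace (Pi_mat k r t a ^\<^sub>m n) * x ^ r)
    = (\<Sum>f | f \<in> {..<n} \<rightarrow>\<^sub>E states k t \<and> (\<forall>m<n. (\<Sum>j=1..t. f m j) = (\<Sum>j=1..t. f 0 j)).
        of_nat (fact k) ^ n * walk_weight k t n a f * x ^ (\<Sum>j=1..t. f 0 j))"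
proof -
  let ?w = "\<lambda>f. of_nat (fact k) ^ n * walk_weight k t n a f * x ^ (\<Sum>j=1..t. f 0 j)"
  let ?B = "{f. f \<in> {..<n} \<rightarrow>\<^sub>E states k t \<and> (\<forall>m<n. (\<Sum>j=1..t. f m j) = (\<Sum>j=1..t. f 0 j))}"
  have "(\<Sum>r=0..k * t. mat_trace (Pi_mat k r t a ^\<^sub>m n) * x ^ r)
      = (\<Sum>r=0..k * t. \<Sum>f | f \<in> ?B \<and> (\<Sum>j=1..t. f 0 j) = r. ?w f)"
  proof (rule sum.cong[OF refl])
    fix r
    have "{f. f \<in> ?B \<and> (\<Sum>j=1..t. f 0 j) = r} = {..<n} \<rightarrow>\<^sub>E {l \<in> states k t. (\<Sum>i=1..t. l i) = r}"
    proof (intro equalityI subsetI)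
      fix f assume "f \<in> {f. f \<in> ?B \<and> (\<Sum>j=1..t. f 0 j) = r}"
      then have "f \<in> {..<n} \<rightarrow>\<^sub>E states k t" "\<And>m. m < n \<Longrightarrow> (\<Sum>j=1..t. f m j) = r" by simp_all
      then show "f \<in> {..<n} \<rightarrow>\<^sub>E {l \<in> states k t. (\<Sum>i=1..t. l i) = r}" by (simp add: PiE_iff)
    next
      fix f assume "f \<in> {..<n} \<rightarrow>\<^sub>E {l \<in> states k t. (\<Sum>i=1..t. l i) = r}"
      then have "f \<in> {..<n} \<rightarrow>\<^sub>E states k t" "\<And>m. m < n \<Longrightarrow> (\<Sum>j=1..t. f m j) = r"
        by (simp_all add: PiE_iff)
      then show "f \<in> {f. f \<in> ?B \<and> (\<Sum>j=1..t. f 0 j) = r}" using n by simp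
    qed
    then show "mat_trace (Pi_mat k r t a ^\<^sub>m n) * x ^ r
        = (\<Sum>f | f \<in> ?B \<and> (\<Sum>j=1..t. f 0 j) = r. ?w f)"
      unfolding mat_trace_Pi_mat_power[OF n] sum_distrib_right
      by (intro sum.cong) auto
  qed
  also have "\<dots> = sum ?w ?B"
  proof (rule sum.group)
    have "finite ({..<n} \<rightarrow>\<^sub>E states k t)" using finite_states by (intro finite_PiE) auto
    then show "finite ?B" by (rule finite_subset[rotated]) auto
    show "(\<lambda>f. \<Sum>j=1..t. f 0 j) ` ?B \<subseteq> {0..k * t}"
    proof clarify
      fix f assume "f \<in> {..<n} \<rightarrow>\<^sub>E states k t"
      then have "f 0 \<in> states k t" using n by (auto simp: PiE_iff)
      \<comment> \<open>Each of the \<open>t\<close> multiplicities is at most \<open>k\<close>, so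
        the range of \<open>r\<close> misses no walk.\<close>
      then have "(\<Sum>j=1..t. f 0 j) \<le> of_nat (card {1..t}) * k"
        by (intro sum_bounded_above) (auto simp: states_def)
      then show "(\<Sum>j=1..t. f 0 j) \<in> {0..k * t}" by (simp add: mult.commute)
    qed
  qed simp
  finally show ?thesis .
qed

section \<open>Cyclic blocks and the levels of a colouring\<close>

text \<open>Positions start at 1 but blocks at 0, so that blocks are residues modulo
  \<open>n\<close>.\<close>

definition block :: "nat \<Rightarrow> nat \<Rightarrow> nat" where
  "block k i = (i - 1) div k"

text \<open>Imagine that the element \<open>i\<close> is thrown \<open>\<alpha> i\<close> blocks forward, cyclically modulo \<open>n\<close>.
  \<open>level k n \<alpha> m j\<close> counts those that are still in flight or just landing at block \<open>m\<close> after \<open>j\<close> steps,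
  \<open>drops k n \<alpha> m j\<close> those that land there.\<close>

definition level :: "nat \<Rightarrow> nat \<Rightarrow> (nat \<Rightarrow> nat) \<Rightarrow> nat \<Rightarrow> nat \<Rightarrow> nat" where
  "level k n \<alpha> m j = card {i\<in>{1..n * k}. (block k i + j) mod n = m \<and> j \<le> \<alpha> i}"

definition drops :: "nat \<Rightarrow> nat \<Rightarrow> (nat \<Rightarrow> nat) \<Rightarrow> nat \<Rightarrow> nat \<Rightarrow> nat" where
  "drops k n \<alpha> m j = card {i\<in>{1..n * k}. (block k i + j) mod n = m \<and> \<alpha> i = j}"

lemma block_less: "i \<in> {1..n * k} \<Longrightarrow> block k i < n"
  unfolding block_def by (rule less_mult_imp_div_less) auto

lemma card_block:
  assumes "m < n" "k \<ge> 1"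
  shows "card {i\<in>{1..n * k}. block k i = m} = k"
proof -
  have "{i\<in>{1..n * k}. block k i = m} = {m * k + 1..m * k + k}"
  proof (intro equalityI subsetI)
    fix i assume "i \<in> {i\<in>{1..n * k}. block k i = m}"
    then have i: "1 \<le> i" "(i - 1) div k = m" by (auto simp: block_def)
    have "m * k \<le> i - 1" using i(2) div_times_less_eq_dividend[of "i - 1" k] by simp
    moreover have "i - 1 < Suc m * k" using i(2) assms(2) dividend_less_div_times[of k "i - 1"] by simp
    ultimately show "i \<in> {m * k + 1..m * k + k}"
      unfolding atLeastAtMost_iff mult_Suc using i(1) by linarith
  next
    fix i assume i: "i \<in> {m * k + 1..m * k + k}"
    have "(i - 1) div k = m" using i by (intro div_nat_eqI) (auto simp: mult.commute)
    moreover have "Suc m * k \<le> n * k" using assms by (intro mult_right_mono) auto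
    then have "i \<le> n * k" using i by simp
    ultimately show "i \<in> {i\<in>{1..n * k}. block k i = m}" using i by (auto simp: block_def)
  qed
  then show ?thesis by simp
qed

lemma Suc_mod_eq_iff:
  fixes b m n :: nat
  assumes "m < n"
  shows "Suc b mod n = Suc m mod n \<longleftrightarrow> b mod n = m"
proof -
  have "[Suc b = Suc m] (mod n) \<longleftrightarrow> [b = m] (mod n)"
    using cong_add_rcancel_nat[of b 1 m n] by simp
  then show ?thesis using assms by (simp add: cong_def)
qed

lemma add_mod_eq_iff:
  fixes b j m n :: nat
  assumes "b < n" "m < n"
  shows "(b + j) mod n = (m + j) mod n \<longleftrightarrow> b = m"
  using cong_add_rcancel_nat[of b j m n] assms by (simp add: cong_def)

lemma bij_betw_add_mod:
  fixes j n :: nat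
  assumes "n \<ge> 1"
  shows "bij_betw (\<lambda>m. (m + j) mod n) {..<n} {..<n}"
proof -
  have "inj_on (\<lambda>m. (m + j) mod n) {..<n}"
    by (intro inj_onI) (simp add: add_mod_eq_iff)
  moreover have "(\<lambda>m. (m + j) mod n) ` {..<n} \<subseteq> {..<n}" using assms by auto
  ultimately show ?thesis by (simp add: bij_betw_def endo_inj_surj)
qed

lemma level_0: "m < n \<Longrightarrow> k \<ge> 1 \<Longrightarrow> level k n \<alpha> m 0 = k"
  using card_block[of m n k] block_less[of _ n k]
  by (simp add: level_def cong: conj_cong)

text \<open>What reaches block \<open>m\<close> after \<open>j\<close> steps either lands there or
  flies on to the next block.\<close>

lemma level_step:
  assumes "m < n"
  shows "level k n \<alpha> m j = drops k n \<alpha> m j + level k n \<alpha> (Suc m mod n) (Suc j)"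
proof -
  have "{i\<in>{1..n * k}. (block k i + j) mod n = m \<and> j \<le> \<alpha> i}
      = {i\<in>{1..n * k}. (block k i + j) mod n = m \<and> \<alpha> i = j}
        \<union> {i\<in>{1..n * k}. (block k i + Suc j) mod n = Suc m mod n \<and> Suc j \<le> \<alpha> i}"
    using Suc_mod_eq_iff[OF assms] by auto
  then show ?thesis unfolding level_def drops_def
    by (simp only:) (intro card_Un_disjoint; auto)
qed

lemma level_beyond:
  assumes "\<alpha> \<in> {1..n * k} \<rightarrow>\<^sub>E {..t}" "t < j"
  shows "level k n \<alpha> m j = 0"
proof -
  have "\<alpha> i \<le> t" if "i \<in> {1..n * k}" for i using assms(1) that by auto
  then have "{i\<in>{1..n * k}. (block k i + j) mod n = m \<and> j \<le> \<alpha> i} = {}"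
    using assms(2) by fastforce
  then show ?thesis unfolding level_def by (simp only: card.empty)
qed

text \<open>Level 0 is \<open>k\<close>, and the levels beyond \<open>t\<close> vanish for colours
  up to \<open>t\<close>; so \<open>{1..t}\<close> carries all the information and
  \<open>pad\<close> restores the rest.\<close>

definition profile :: "nat \<Rightarrow> nat \<Rightarrow> nat \<Rightarrow> (nat \<Rightarrow> nat) \<Rightarrow> nat \<Rightarrow> nat \<Rightarrow> nat" where
  "profile k t n \<alpha> = (\<lambda>m\<in>{..<n}. \<lambda>j\<in>{1..t}. level k n \<alpha> m j)"

lemma pad_profile:
  assumes "\<alpha> \<in> {1..n * k} \<rightarrow>\<^sub>E {..t}" "k \<ge> 1" "m < n"
  shows "pad k t (profile k t n \<alpha> m) j = level k n \<alpha> m j"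
  using assms level_0[of m n k \<alpha>] level_beyond[of \<alpha> n k t j m]
  by (auto simp: pad_def profile_def)

text \<open>All elements at block \<open>m\<close> after \<open>j\<close> steps started in one and
  the same block.\<close>

lemma level_le:
  assumes "m < n" "k \<ge> 1"
  shows "level k n \<alpha> m j \<le> k"
proof -
  obtain m' where m': "m' < n" "(m' + j) mod n = m"
  proof -
    have "m \<in> (\<lambda>m. (m + j) mod n) ` {..<n}"
      using bij_betw_add_mod[of n j] assms by (simp add: bij_betw_def)
    then show ?thesis using that by auto
  qed
  have "level k n \<alpha> m j \<le> card {i\<in>{1..n * k}. block k i = m'}"
    unfolding level_def
  proof (rule card_mono)
    show "{i\<in>{1..n * k}. (block k i + j) mod n = m \<and> j \<le> \<alpha> i} \<subseteq> {i\<in>{1..n * k}. block k i = m'}"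
      using m' add_mod_eq_iff[OF block_less m'(1)] by auto
  qed simp
  then show ?thesis using card_block[OF m'(1) assms(2)] by simp
qed

lemma profile_in:
  assumes "k \<ge> 1"
  shows "profile k t n \<alpha> \<in> {..<n} \<rightarrow>\<^sub>E states k t"
  using level_le[OF _ assms] by (auto simp: profile_def states_def)

text \<open>Regrouped by starting block instead of current block, levels become the sizes prescribed
  in \<open>card_functions_prescribed_levels\<close>.\<close>

lemma card_profile:
  assumes "k \<ge> 1" "n \<ge> 1" and f: "f \<in> {..<n} \<rightarrow>\<^sub>E states k t"
  shows "card {\<alpha> \<in> {1..n * k} \<rightarrow>\<^sub>E {..t}. profile k t n \<alpha> = f}
    = (\<Prod>m<n. \<Prod>j\<le>t. pad k t (f m) j choose pad k t (f (Suc m mod n)) (Suc j))"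
proof -
  \<comment> \<open>Elements starting in block \<open>m\<close> are at block
    \<open>(m + j) mod n\<close> after \<open>j\<close> steps.\<close>
  define d where "d = (\<lambda>m j. pad k t (f ((m + j) mod n)) j)"
  have card_level: "card {i\<in>{1..n * k}. block k i = m \<and> j \<le> \<alpha> i} = level k n \<alpha> ((m + j) mod n) j"
    if "m < n" for m j \<alpha>
    unfolding level_def using add_mod_eq_iff[OF block_less that]
    by (intro arg_cong[where f = card] Collect_cong) auto
  have eq: "{\<alpha> \<in> {1..n * k} \<rightarrow>\<^sub>E {..t}. profile k t n \<alpha> = f}
      = {\<alpha> \<in> {1..n * k} \<rightarrow>\<^sub>E {..t}.
          \<forall>m\<in>{..<n}. \<forall>j\<le>t. card {i\<in>{1..n * k}. block k i = m \<and> j \<le> \<alpha> i} = d m j}"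
  proof (rule Collect_cong, rule conj_cong[OF refl])
    fix \<alpha> assume \<alpha>: "\<alpha> \<in> {1..n * k} \<rightarrow>\<^sub>E {..t}"
    have "profile k t n \<alpha> = f \<longleftrightarrow> (\<forall>m<n. \<forall>j\<in>{1..t}. level k n \<alpha> m j = f m j)"
    proof
      assume r: "\<forall>m<n. \<forall>j\<in>{1..t}. level k n \<alpha> m j = f m j"
      have "profile k t n \<alpha> m = f m" if "m < n" for m
      proof (rule extensionalityI[of _ "{1..t}"])
        show "f m \<in> extensional {1..t}" using f that by (auto simp: states_def PiE_iff)
      qed (use r that in \<open>auto simp: profile_def\<close>)
      then show "profile k t n \<alpha> = f"
        using f by - (rule extensionalityI[of _ "{..<n}"], auto simp: profile_def PiE_def)
    qed (auto simp: profile_def)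
    also have "\<dots> \<longleftrightarrow> (\<forall>j\<in>{1..t}. \<forall>m<n. level k n \<alpha> m j = f m j)" by blast
    also have "\<dots> \<longleftrightarrow> (\<forall>j\<le>t. \<forall>m<n. level k n \<alpha> m j = pad k t (f m) j)"
      using level_0[of _ n k \<alpha>] assms(1) by (auto simp: pad_def)
    also have "\<dots> \<longleftrightarrow> (\<forall>j\<le>t. \<forall>m<n. level k n \<alpha> ((m + j) mod n) j = d m j)"
    proof -
      \<comment> \<open>For fixed \<open>j\<close>, adding \<open>j\<close> only permutes the
        blocks.\<close>
      have "(\<forall>m\<in>{..<n}. P m) \<longleftrightarrow> (\<forall>m\<in>{..<n}. P ((m + j) mod n))" for P j
        by (subst bij_betw_imp_surj_on[OF bij_betw_add_mod[OF assms(2), of j], symmetric]) blast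
      from this[of "\<lambda>m. level k n \<alpha> m j = pad k t (f m) j" j for j] show ?thesis
        by (simp add: d_def Ball_def)
    qed
    also have "\<dots> \<longleftrightarrow> (\<forall>m\<in>{..<n}. \<forall>j\<le>t. card {i\<in>{1..n * k}. block k i = m \<and> j \<le> \<alpha> i} = d m j)"
      using card_level by auto
    finally show "profile k t n \<alpha> = f \<longleftrightarrow> \<dots>" .
  qed
  have "card {\<alpha> \<in> {1..n * k} \<rightarrow>\<^sub>E {..t}. profile k t n \<alpha> = f}
      = (\<Prod>m<n. \<Prod>j<t. d m j choose d m (Suc j))"
    unfolding eq using block_less card_block assms
    by (intro card_functions_prescribed_levels) (auto simp: d_def pad_def)
  also have "\<dots> = (\<Prod>m<n. \<Prod>j\<le>t. d m j choose d m (Suc j))"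
  proof -
    \<comment> \<open>Nothing flies beyond \<open>t\<close>, so the extra factor at
      \<open>j = t\<close> is a binomial with lower entry 0.\<close>
    have "d m (Suc t) = 0" for m by (simp add: d_def pad_def)
    then show ?thesis unfolding lessThan_Suc_atMost[symmetric] prod.lessThan_Suc by simp
  qed
  \<comment> \<open>The shift of blocks depends on \<open>j\<close>, so reindexing is done with
    \<open>j\<close> outermost.\<close>
  also have "\<dots> = (\<Prod>j\<le>t. \<Prod>m<n. d m j choose d m (Suc j))" by (rule prod.swap)
  also have "\<dots> = (\<Prod>j\<le>t. \<Prod>m<n. pad k t (f m) j choose pad k t (f (Suc m mod n)) (Suc j))"
  proof (rule prod.cong[OF refl])
    fix j
    have "(\<Prod>m<n. pad k t (f m) j choose pad k t (f (Suc m mod n)) (Suc j))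
      = (\<Prod>m<n. pad k t (f ((m + j) mod n)) j choose pad k t (f (Suc ((m + j) mod n) mod n)) (Suc j))"
      by (rule prod.reindex_bij_betw[OF bij_betw_add_mod[OF assms(2)], symmetric])
    then show "(\<Prod>m<n. d m j choose d m (Suc j))
      = (\<Prod>m<n. pad k t (f m) j choose pad k t (f (Suc m mod n)) (Suc j))"
      by (simp add: d_def mod_Suc_eq)
  qed
  also have "\<dots> = (\<Prod>m<n. \<Prod>j\<le>t. pad k t (f m) j choose pad k t (f (Suc m mod n)) (Suc j))"
    by (rule prod.swap)
  finally show ?thesis .
qed

lemma card_target_block:
  assumes "\<alpha> \<in> {1..n * k} \<rightarrow>\<^sub>E {..t}"
  shows "card {i\<in>{1..n * k}. (block k i + \<alpha> i) mod n = m} = (\<Sum>j\<le>t. drops k n \<alpha> m j)"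
proof -
  have "\<alpha> ` {i\<in>{1..n * k}. (block k i + \<alpha> i) mod n = m} \<subseteq> {..t}"
    using assms by auto
  then have "(\<Sum>j\<le>t. card {i\<in>{i\<in>{1..n * k}. (block k i + \<alpha> i) mod n = m}. \<alpha> i = j})
      = card {i\<in>{1..n * k}. (block k i + \<alpha> i) mod n = m}"
    using sum.group[of "{i\<in>{1..n * k}. (block k i + \<alpha> i) mod n = m}" "{..t}" \<alpha> "\<lambda>_. 1::nat"]
    by simp
  moreover have "{i\<in>{i\<in>{1..n * k}. (block k i + \<alpha> i) mod n = m}. \<alpha> i = j}
      = {i\<in>{1..n * k}. (block k i + j) mod n = m \<and> \<alpha> i = j}" for j by auto
  ultimately show ?thesis by (simp add: drops_def)
qed

text \<open>Going from block \<open>m\<close> to block \<open>m + 1\<close>, exactly \<open>k\<close> elements are thrown, so the number in flight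
  is unchanged iff exactly \<open>k\<close> land.\<close>

lemma balanced_iff:
  assumes \<alpha>: "\<alpha> \<in> {1..n * k} \<rightarrow>\<^sub>E {..t}" and k: "k \<ge> 1"
  shows "(\<forall>m<n. card {i\<in>{1..n * k}. (block k i + \<alpha> i) mod n = m} = k)
    \<longleftrightarrow> (\<forall>m<n. (\<Sum>j=1..t. level k n \<alpha> m j) = (\<Sum>j=1..t. level k n \<alpha> 0 j))"
    (is "?L \<longleftrightarrow> (\<forall>m<n. ?H m = ?H 0)")
proof -
  \<comment> \<open>\<open>level_step\<close> is summed over \<open>j\<close>: level 0 supplies the
    \<open>k\<close> thrown elements, the drops are those that land, and the shifted levels are
    those in flight at the next block. The additive form avoids truncated subtraction.\<close>
  have bal: "card {i\<in>{1..n * k}. (block k i + \<alpha> i) mod n = m} + ?H (Suc m mod n) = k + ?H m"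
    if m: "m < n" for m
  proof -
    have "(\<Sum>j\<le>t. level k n \<alpha> m j) = k + ?H m"
      using level_0[OF m k] by (simp add: sum.atMost_shift sum.atLeast1_atMost_eq atMost_atLeast0 sum.atLeast_Suc_atMost)
    moreover have "(\<Sum>j\<le>t. level k n \<alpha> (Suc m mod n) (Suc j)) = ?H (Suc m mod n)"
    proof -
      have "(\<Sum>j\<le>t. level k n \<alpha> (Suc m mod n) (Suc j)) = (\<Sum>j=1..Suc t. level k n \<alpha> (Suc m mod n) j)"
        by (intro sum.reindex_bij_witness[where i = "\<lambda>j. j - 1" and j = Suc]) auto
      then show ?thesis using level_beyond[OF \<alpha>] by simp
    qed
    moreover have "(\<Sum>j\<le>t. level k n \<alpha> m j)
        = (\<Sum>j\<le>t. drops k n \<alpha> m j) + (\<Sum>j\<le>t. level k n \<alpha> (Suc m mod n) (Suc j))"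
      unfolding sum.distrib[symmetric] by (intro sum.cong refl level_step[OF m])
    ultimately show ?thesis unfolding card_target_block[OF \<alpha>] by linarith
  qed
  have "?L \<longleftrightarrow> (\<forall>m<n. ?H (Suc m mod n) = ?H m)"
  proof (intro iff_allI imp_cong refl)
    fix m assume "m < n"
    from bal[OF this] show "card {i\<in>{1..n * k}. (block k i + \<alpha> i) mod n = m} = k \<longleftrightarrow> ?H (Suc m mod n) = ?H m"
      by linarith
  qed
  also have "\<dots> \<longleftrightarrow> (\<forall>m<n. ?H m = ?H 0)"
  proof
    assume step: "\<forall>m<n. ?H (Suc m mod n) = ?H m"
    have "m < n \<longrightarrow> ?H m = ?H 0" for m
    proof (induction m)
      case (Suc m)
      then show ?case using step[rule_format, of m] by auto
    qed simp
    then show "\<forall>m<n. ?H m = ?H 0" by blast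
  next
    assume eq: "\<forall>m<n. ?H m = ?H 0"
    show "\<forall>m<n. ?H (Suc m mod n) = ?H m"
    proof (intro allI impI)
      fix m assume "m < n"
      moreover from this have "Suc m mod n < n" by simp
      ultimately show "?H (Suc m mod n) = ?H m" using eq by metis
    qed
  qed
  finally show ?thesis .
qed

section \<open>The monomial and the exponent of a colouring\<close>

text \<open>The elements are grouped by landing block and colour.\<close>

lemma prod_colours_eq_drops:
  fixes a :: "nat \<Rightarrow> 'a::comm_monoid_mult"
  assumes "\<alpha> \<in> {1..n * k} \<rightarrow>\<^sub>E {..t}" "n \<ge> 1"
  shows "(\<Prod>i=1..n * k. a (\<alpha> i)) = (\<Prod>m<n. \<Prod>j\<le>t. a j ^ drops k n \<alpha> m j)"
proof -
  let ?g = "\<lambda>i. ((block k i + \<alpha> i) mod n, \<alpha> i)"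
  have "(\<Prod>i=1..n * k. a (\<alpha> i)) = (\<Prod>p\<in>{..<n} \<times> {..t}. \<Prod>i | i \<in> {1..n * k} \<and> ?g i = p. a (\<alpha> i))"
    using assms by (intro prod.group[symmetric]) auto
  also have "\<dots> = (\<Prod>(m, j)\<in>{..<n} \<times> {..t}. a j ^ drops k n \<alpha> m j)"
  proof (rule prod.cong[OF refl], clarify)
    fix m j
    have "{i. i \<in> {1..n * k} \<and> ?g i = (m, j)} = {i\<in>{1..n * k}. (block k i + j) mod n = m \<and> \<alpha> i = j}"
      by auto
    moreover have "(\<Prod>i | i \<in> {1..n * k} \<and> ?g i = (m, j). a (\<alpha> i)) = (\<Prod>i | i \<in> {1..n * k} \<and> ?g i = (m, j). a j)"
      by (intro prod.cong) auto
    ultimately show "(\<Prod>i | i \<in> {1..n * k} \<and> ?g i = (m, j). a (\<alpha> i)) = a j ^ drops k n \<alpha> m j"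
      by (simp add: drops_def)
  qed
  finally show ?thesis by (simp add: prod.cartesian_product)
qed

text \<open>Starting from \<open>b < n\<close>, the quotient grows by one whenever a multiple of
  \<open>n\<close> is reached.\<close>

lemma add_div_eq_card:
  fixes b c n :: nat
  assumes "b < n"
  shows "(b + c) div n = card {j\<in>{1..c}. (b + j) mod n = 0}"
proof (induction c)
  case 0
  then show ?case using assms by simp
next
  case (Suc c)
  have "{j\<in>{1..Suc c}. (b + j) mod n = 0}
      = (if (b + Suc c) mod n = 0 then insert (Suc c) {j\<in>{1..c}. (b + j) mod n = 0}
         else {j\<in>{1..c}. (b + j) mod n = 0})"
    by (auto simp: le_Suc_eq)
  then show ?case using Suc by (simp add: div_Suc)
qed

text \<open>Each quotient is the number of passages of one element from the last block to block 0.
  Sorted by the step \<open>j\<close> at which they occur, these passages are counted by the levels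
  at block 0.\<close>

lemma sum_div_eq_level:
  assumes \<alpha>: "\<alpha> \<in> {1..n * k} \<rightarrow>\<^sub>E {..t}"
  shows "(\<Sum>i=1..n * k. (block k i + \<alpha> i) div n) = (\<Sum>j=1..t. level k n \<alpha> 0 j)"
proof -
  have "(\<Sum>i=1..n * k. (block k i + \<alpha> i) div n)
      = (\<Sum>i=1..n * k. \<Sum>j | j \<in> {1..t} \<and> ((block k i + j) mod n = 0 \<and> j \<le> \<alpha> i). 1)"
  proof (rule sum.cong[OF refl])
    fix i assume i: "i \<in> {1..n * k}"
    have "\<alpha> i \<le> t" using \<alpha> i by auto
    then have "{j\<in>{1..\<alpha> i}. (block k i + j) mod n = 0} = {j. j \<in> {1..t} \<and> ((block k i + j) mod n = 0 \<and> j \<le> \<alpha> i)}"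
      by auto
    then show "(block k i + \<alpha> i) div n = (\<Sum>j | j \<in> {1..t} \<and> ((block k i + j) mod n = 0 \<and> j \<le> \<alpha> i). 1)"
      using add_div_eq_card[OF block_less[OF i]] by simp
  qed
  also have "\<dots> = (\<Sum>j=1..t. \<Sum>i | i \<in> {1..n * k} \<and> ((block k i + j) mod n = 0 \<and> j \<le> \<alpha> i). 1)"
    by (rule sum.swap_restrict) auto
  finally show ?thesis by (simp add: level_def)
qed

lemma admissible_colourings_eq:
  assumes \<sigma>: "\<sigma> permutes {1..n * k}"
  shows "admissible_colourings k t n \<sigma>
    = {\<alpha> \<in> {1..n * k} \<rightarrow>\<^sub>E {..t}. \<forall>i\<in>{1..n * k}. block k (\<sigma> i) = (block k i + \<alpha> i) mod n}"
proof -
  have int_block: "(int i - 1) div int k = int (block k i)" if "i \<in> {1..n * k}" for i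
    using that by (simp add: block_def zdiv_int of_nat_diff)
  have "[(int (\<sigma> i) - 1) div int k - (int i - 1) div int k = int (\<alpha> i)] (mod int n)
      \<longleftrightarrow> block k (\<sigma> i) = (block k i + \<alpha> i) mod n" if i: "i \<in> {1..n * k}" for i and \<alpha> :: "nat \<Rightarrow> nat"
  proof -
    have \<sigma>i: "\<sigma> i \<in> {1..n * k}" using permutes_in_image[OF \<sigma>] i by blast
    have "[(int (\<sigma> i) - 1) div int k - (int i - 1) div int k = int (\<alpha> i)] (mod int n)
        \<longleftrightarrow> [int (block k (\<sigma> i)) = int (block k i + \<alpha> i)] (mod int n)"
      unfolding int_block[OF i] int_block[OF \<sigma>i] by (simp add: cong_iff_dvd_diff algebra_simps)
    then show ?thesis
      using block_less[OF \<sigma>i] by (simp only: cong_int_iff) (simp add: cong_def)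
  qed
  then show ?thesis unfolding admissible_colourings_def atLeast0AtMost by blast
qed

text \<open>The full turns of a throw are counted by \<open>\<alpha> i div n\<close>; the rest
  crosses the cut at most once, and does so iff the element arrives in an earlier block.\<close>

lemma exponent_eq:
  assumes \<sigma>: "\<sigma> permutes {1..n * k}"
    and \<alpha>: "\<forall>i\<in>{1..n * k}. block k (\<sigma> i) = (block k i + \<alpha> i) mod n"
  shows "card {i \<in> {1..n * k}. \<sigma> i < i \<and> \<not> [\<alpha> i = 0] (mod n)} + (\<Sum>i=1..n * k. \<alpha> i div n)
    = (\<Sum>i=1..n * k. (block k i + \<alpha> i) div n)"
proof -
  have "(\<Sum>i=1..n * k. (block k i + \<alpha> i) div n)
      = (\<Sum>i=1..n * k. (if \<sigma> i < i \<and> \<not> [\<alpha> i = 0] (mod n) then 1 else 0) + \<alpha> i div n)"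
  proof (rule sum.cong[OF refl])
    fix i assume i: "i \<in> {1..n * k}"
    define b s q \<rho> where "b = block k i" and "s = block k (\<sigma> i)" and "q = \<alpha> i div n" and "\<rho> = \<alpha> i mod n"
    have b: "b < n" unfolding b_def using block_less[OF i] .
    have \<rho>: "\<rho> < n" unfolding \<rho>_def using b by simp
    have \<alpha>i: "\<alpha> i = n * q + \<rho>" by (simp add: q_def \<rho>_def)
    have s: "s = (b + \<rho>) mod n" using \<alpha> i by (simp add: s_def b_def \<rho>_def mod_add_right_eq)
    have d: "(b + \<alpha> i) div n = q + (b + \<rho>) div n"
    proof -
      have "b + \<alpha> i = (b + \<rho>) + q * n" by (simp add: \<alpha>i)
      then show ?thesis using b by (simp only: div_mult_self1)
    qed
    \<comment> \<open>Positions in different blocks are ordered like their blocks.\<close>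
    have lt: "\<sigma> i < i \<longleftrightarrow> s < b" if "s \<noteq> b"
    proof -
      have "s \<le> b" if "\<sigma> i \<le> i"
        unfolding s_def b_def block_def using that by (intro div_le_mono) simp
      moreover have "b \<le> s" if "i \<le> \<sigma> i"
        unfolding s_def b_def block_def using that by (intro div_le_mono) simp
      ultimately show ?thesis using \<open>s \<noteq> b\<close> by linarith
    qed
    have c: "[\<alpha> i = 0] (mod n) \<longleftrightarrow> \<rho> = 0" by (simp add: cong_def \<rho>_def)
    consider "\<rho> = 0" | "\<rho> \<noteq> 0" "b + \<rho> < n" | "\<rho> \<noteq> 0" "n \<le> b + \<rho>" by linarith
    then have "(b + \<alpha> i) div n = (if \<sigma> i < i \<and> \<not> [\<alpha> i = 0] (mod n) then 1 else 0) + q"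
    proof cases
      case 1
      \<comment> \<open>Here \<open>s = b\<close>, and \<open>\<sigma> i < i\<close> may hold
        without a crossing; the exponent excludes such colours.\<close>
      then show ?thesis using b d c by simp
    next
      case 2
      then have "s = b + \<rho>" using s by simp
      then show ?thesis using 2 d c lt by simp
    next
      case 3
      \<comment> \<open>The cut is crossed once, and \<open>s = b + \<rho> - n\<close> is below
        \<open>b\<close> because \<open>\<rho> < n\<close>.\<close>
      then have "b + \<rho> - n < n" using b \<rho> by linarith
      then have "(b + \<rho>) mod n = b + \<rho> - n" "(b + \<rho>) div n = 1"
        using 3 by (simp_all add: le_mod_geq le_div_geq)
      then show ?thesis using 3 s d c lt \<rho> by simp
    qed
    then show "(block k i + \<alpha> i) div n = (if \<sigma> i < i \<and> \<not> [\<alpha> i = 0] (mod n) then 1 else 0) + \<alpha> i div n"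
      by (simp add: b_def q_def)
  qed
  then show ?thesis by (simp add: sum.distrib sum.If_cases Int_def)
qed

section \<open>Double counting of permutations and colourings\<close>

(* The independent variables are rendered by arbitrary elements of an arbitrary commutative
   ring, which includes the indeterminates of a polynomial ring. *)
theorem theorem16:
  fixes k t n :: nat and a :: "nat \<Rightarrow> 'a::comm_ring_1" and x :: 'a
  assumes "k \<ge> 1" and "t \<ge> 0" and "n \<ge> 1"
  shows "(\<Sum>\<sigma> | \<sigma> permutes {1..n * k}. \<Sum>\<alpha>\<in>admissible_colourings k t n \<sigma>.
            (\<Prod>i=1..n * k. a (\<alpha> i))
            * x ^ (card {i \<in> {1..n * k}. \<sigma> i < i \<and> \<not> [\<alpha> i = 0] (mod n)}
                   + (\<Sum>i=1..n * k. \<alpha> i div n)))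
         = (\<Sum>r=0..k * t. mat_trace (Pi_mat k r t a ^\<^sub>m n) * x ^ r)"
proof -
  let ?A = "{1..n * k}" and ?C = "{1..n * k} \<rightarrow>\<^sub>E {..t}" and ?F = "{..<n} \<rightarrow>\<^sub>E states k t"
  let ?compat = "\<lambda>\<sigma> \<alpha>. \<forall>i\<in>?A. block k (\<sigma> i) = (block k i + \<alpha> i) mod n"
  let ?H = "\<lambda>f. \<Sum>j=1..t. f 0 j :: nat"
  define bal where "bal = (\<lambda>f. \<forall>m<n. (\<Sum>j=1..t. f m j) = (\<Sum>j=1..t. f 0 j :: nat))"
  \<comment> \<open>\<open>W\<close> is the monomial part of \<open>walk_weight\<close>, without the
    binomials.\<close>
  define W where "W = (\<lambda>f. (\<Prod>m<n. \<Prod>j\<le>t. a j ^ (pad k t (f m) j - pad k t (f (Suc m mod n)) (Suc j))))"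
  have finC: "finite ?C" by (intro finite_PiE) auto
  have finF: "finite ?F" using finite_states by (intro finite_PiE) auto
  have level: "(\<Sum>j=1..t. level k n \<alpha> m j) = (\<Sum>j=1..t. profile k t n \<alpha> m j)" if "m < n" for \<alpha> m
    using that by (simp add: profile_def)
  \<comment> \<open>For compatible pairs the summand does not depend on \<sigma>, and on \<alpha>
    only through its profile.\<close>
  have term_eq: "(\<Prod>i\<in>?A. a (\<alpha> i)) * x ^ (card {i \<in> ?A. \<sigma> i < i \<and> \<not> [\<alpha> i = 0] (mod n)} + (\<Sum>i\<in>?A. \<alpha> i div n))
      = W (profile k t n \<alpha>) * x ^ ?H (profile k t n \<alpha>)"
    if \<sigma>: "\<sigma> permutes ?A" and \<alpha>: "\<alpha> \<in> ?C" and compat: "?compat \<sigma> \<alpha>" for \<sigma> \<alpha>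
  proof -
    have "(\<Prod>i\<in>?A. a (\<alpha> i)) = W (profile k t n \<alpha>)"
      unfolding W_def prod_colours_eq_drops[OF \<alpha> assms(3)]
    proof (intro prod.cong refl)
      fix m j assume "m \<in> {..<n}"
      then have m: "m < n" "Suc m mod n < n" by auto
      show "a j ^ drops k n \<alpha> m j = a j ^ (pad k t (profile k t n \<alpha> m) j - pad k t (profile k t n \<alpha> (Suc m mod n)) (Suc j))"
        unfolding pad_profile[OF \<alpha> assms(1) m(1)] pad_profile[OF \<alpha> assms(1) m(2)]
        by (simp add: level_step[OF m(1)])
    qed
    moreover have "card {i \<in> ?A. \<sigma> i < i \<and> \<not> [\<alpha> i = 0] (mod n)} + (\<Sum>i\<in>?A. \<alpha> i div n)
        = ?H (profile k t n \<alpha>)"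
      using exponent_eq[OF \<sigma> compat] sum_div_eq_level[OF \<alpha>] level assms(3) by simp
    ultimately show ?thesis by simp
  qed
  have card_eq: "card {\<sigma>. \<sigma> permutes ?A \<and> ?compat \<sigma> \<alpha>} = (if bal (profile k t n \<alpha>) then fact k ^ n else 0)"
    if \<alpha>: "\<alpha> \<in> ?C" for \<alpha>
  proof -
    have "card {\<sigma>. \<sigma> permutes ?A \<and> ?compat \<sigma> \<alpha>}
        = (if \<forall>m\<in>{..<n}. card {i\<in>?A. (block k i + \<alpha> i) mod n = m} = k then fact k ^ card {..<n} else 0)"
      using block_less card_block assms by (intro card_permutes_prescribed_labels) auto
    also have "(\<forall>m\<in>{..<n}. card {i\<in>?A. (block k i + \<alpha> i) mod n = m} = k) \<longleftrightarrow> bal (profile k t n \<alpha>)"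
      using balanced_iff[OF \<alpha> assms(1)] level assms(3) by (simp add: bal_def Ball_def)
    finally show ?thesis unfolding card_lessThan .
  qed
  have "(\<Sum>\<sigma> | \<sigma> permutes ?A. \<Sum>\<alpha>\<in>admissible_colourings k t n \<sigma>. (\<Prod>i\<in>?A. a (\<alpha> i))
          * x ^ (card {i \<in> ?A. \<sigma> i < i \<and> \<not> [\<alpha> i = 0] (mod n)} + (\<Sum>i\<in>?A. \<alpha> i div n)))
      = (\<Sum>\<sigma> | \<sigma> permutes ?A. \<Sum>\<alpha> | \<alpha> \<in> ?C \<and> ?compat \<sigma> \<alpha>. W (profile k t n \<alpha>) * x ^ ?H (profile k t n \<alpha>))"
  proof (rule sum.cong[OF refl], rule sum.cong)
    fix \<sigma> assume "\<sigma> \<in> {\<sigma>. \<sigma> permutes ?A}"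
    then have \<sigma>: "\<sigma> permutes ?A" by simp
    show "admissible_colourings k t n \<sigma> = {\<alpha>. \<alpha> \<in> ?C \<and> ?compat \<sigma> \<alpha>}"
      using admissible_colourings_eq[OF \<sigma>] .
    fix \<alpha> assume "\<alpha> \<in> {\<alpha>. \<alpha> \<in> ?C \<and> ?compat \<sigma> \<alpha>}"
    then have "\<alpha> \<in> ?C" "?compat \<sigma> \<alpha>" by simp_all
    with \<sigma> show "(\<Prod>i\<in>?A. a (\<alpha> i))
          * x ^ (card {i \<in> ?A. \<sigma> i < i \<and> \<not> [\<alpha> i = 0] (mod n)} + (\<Sum>i\<in>?A. \<alpha> i div n))
        = W (profile k t n \<alpha>) * x ^ ?H (profile k t n \<alpha>)"
      by (rule term_eq)
  qed
  \<comment> \<open>With the colouring outermost, the inner sum is constant and only counts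
    compatible permutations.\<close>
  also have "\<dots> = (\<Sum>\<alpha>\<in>?C. \<Sum>\<sigma> | \<sigma> \<in> {\<sigma>. \<sigma> permutes ?A} \<and> ?compat \<sigma> \<alpha>. W (profile k t n \<alpha>) * x ^ ?H (profile k t n \<alpha>))"
    by (rule sum.swap_restrict[OF _ finC]) (simp add: finite_permutations)
  also have "\<dots> = (\<Sum>\<alpha>\<in>?C. if bal (profile k t n \<alpha>) then of_nat (fact k) ^ n * W (profile k t n \<alpha>) * x ^ ?H (profile k t n \<alpha>) else 0)"
  proof (rule sum.cong[OF refl])
    fix \<alpha> assume \<alpha>: "\<alpha> \<in> ?C"
    show "(\<Sum>\<sigma> | \<sigma> \<in> {\<sigma>. \<sigma> permutes ?A} \<and> ?compat \<sigma> \<alpha>. W (profile k t n \<alpha>) * x ^ ?H (profile k t n \<alpha>))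
      = (if bal (profile k t n \<alpha>) then of_nat (fact k) ^ n * W (profile k t n \<alpha>) * x ^ ?H (profile k t n \<alpha>) else 0)"
      unfolding sum_constant mem_Collect_eq card_eq[OF \<alpha>]
      by (cases "bal (profile k t n \<alpha>)")
        (simp_all only: if_True if_False of_nat_power of_nat_0 mult_zero_left mult.assoc)
  qed
  \<comment> \<open>Grouping by profile turns the sum over colourings into one over walks of
    states.\<close>
  also have "\<dots> = (\<Sum>f\<in>?F. \<Sum>\<alpha> | \<alpha> \<in> ?C \<and> profile k t n \<alpha> = f.
      if bal (profile k t n \<alpha>) then of_nat (fact k) ^ n * W (profile k t n \<alpha>) * x ^ ?H (profile k t n \<alpha>) else 0)"
    by (rule sum.group[OF finC finF, symmetric]) (use profile_in[OF assms(1)] in blast)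
  also have "\<dots> = (\<Sum>f\<in>?F. if bal f then of_nat (fact k) ^ n * walk_weight k t n a f * x ^ ?H f else 0)"
  proof (rule sum.cong[OF refl])
    fix f assume f: "f \<in> ?F"
    \<comment> \<open>The binomials of \<open>walk_weight\<close> count the colourings with profile
      \<open>f\<close>.\<close>
    have "walk_weight k t n a f = of_nat (card {\<alpha> \<in> ?C. profile k t n \<alpha> = f}) * W f"
      unfolding card_profile[OF assms(1,3) f] walk_weight_def W_def by (simp add: prod.distrib)
    moreover have "(\<Sum>\<alpha> | \<alpha> \<in> ?C \<and> profile k t n \<alpha> = f.
        if bal (profile k t n \<alpha>) then of_nat (fact k) ^ n * W (profile k t n \<alpha>) * x ^ ?H (profile k t n \<alpha>) else 0)
      = (\<Sum>\<alpha> | \<alpha> \<in> ?C \<and> profile k t n \<alpha> = f. if bal f then of_nat (fact k) ^ n * W f * x ^ ?H f else 0)"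
    proof (rule sum.cong[OF refl])
      fix \<alpha> assume "\<alpha> \<in> {\<alpha>. \<alpha> \<in> ?C \<and> profile k t n \<alpha> = f}"
      then have eq: "profile k t n \<alpha> = f" by simp
      show "(if bal (profile k t n \<alpha>) then of_nat (fact k) ^ n * W (profile k t n \<alpha>) * x ^ ?H (profile k t n \<alpha>) else 0)
        = (if bal f then of_nat (fact k) ^ n * W f * x ^ ?H f else 0)"
        unfolding eq ..
    qed
    ultimately show "(\<Sum>\<alpha> | \<alpha> \<in> ?C \<and> profile k t n \<alpha> = f.
        if bal (profile k t n \<alpha>) then of_nat (fact k) ^ n * W (profile k t n \<alpha>) * x ^ ?H (profile k t n \<alpha>) else 0)
      = (if bal f then of_nat (fact k) ^ n * walk_weight k t n a f * x ^ ?H f else 0)"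
      by (cases "bal f") (simp_all only: sum_constant if_True if_False mult_zero_left mult_zero_right mult_ac)
  qed
  also have "\<dots> = (\<Sum>f | f \<in> ?F \<and> bal f. of_nat (fact k) ^ n * walk_weight k t n a f * x ^ ?H f)"
    by (rule sum.inter_filter[OF finF, symmetric])
  also have "\<dots> = (\<Sum>r=0..k * t. mat_trace (Pi_mat k r t a ^\<^sub>m n) * x ^ r)"
    unfolding bal_def by (rule sum_trace_Pi_mat_power[OF assms(3), symmetric])
  finally show ?thesis .
qed

end
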